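(* Let $\mathbb{Q}^{\mathrm{tr}}$ denote the field of all totally real algebraic numbers, let $\mathbb{Z}^{\mathrm{tr}}$ denote its ring of integers, and let $i=\sqrt{-1}$. Then $\mathbb{Z}^{\mathrm{tr}}$ is existentially definable in the ring of integers of $\mathbb{Q}^{\mathrm{tr}}(i)$. In particular, the first-order theory of the ring of integers of $\mathbb{Q}^{\mathrm{tr}}(i)$ is undecidable.
   Context: All fields are subfields of a fixed algebraic closure $\overline{\mathbb{Q}}\subseteq\mathbb{C}$. An algebraic number is totally real if all roots of its minimal polynomial over $\mathbb{Q}$ are real. "Existentially definable" means definable by an existential formula in the first-order language of rings $\{+,-,\cdot,0,1\}$; "first-order theory" refers to this language. *)

theory Defs
  imports
    Complex_Main
    "HOL-Library.Nat_Bijection"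
    "HOL-Computational_Algebra.Polynomial"
begin

section \<open>Totally real numbers and rings of integers\<close>

text \<open>The ambient field is \<open>complex\<close>; all number fields are subsets of it with the inherited
  operations.\<close>

definition is_min_poly :: "rat poly \<Rightarrow> complex \<Rightarrow> bool" where
  "is_min_poly p x \<longleftrightarrow> lead_coeff p = 1 \<and> poly (map_poly of_rat p) x = 0 \<and>
     (\<forall>q. q \<noteq> 0 \<and> poly (map_poly of_rat q) x = 0 \<longrightarrow> degree p \<le> degree q)"

lemma is_min_poly_unique:
  assumes "is_min_poly p x" "is_min_poly q x"
  shows "p = q"
proof (rule ccontr)
  assume "p \<noteq> q"
  hence ne: "p - q \<noteq> 0" by simp
  have hom: "map_poly of_rat (p - q) = (map_poly of_rat p - map_poly of_rat q :: complex poly)"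
    by (rule poly_eqI) (simp add: coeff_map_poly of_rat_diff)
  have deg: "degree p = degree q"
    using assms by (metis is_min_poly_def le_antisym leading_coeff_0_iff zero_neq_one)
  have "poly (map_poly of_rat (p - q)) x = 0"
    using assms by (simp add: hom is_min_poly_def)
  hence le: "degree p \<le> degree (p - q)"
    using assms(1) ne by (auto simp: is_min_poly_def)
  moreover have "degree (p - q) \<le> degree p"
    using deg by (metis degree_diff_le order_refl)
  ultimately have "lead_coeff (p - q) = coeff p (degree p) - coeff q (degree q)"
    using deg by simp
  also have "\<dots> = 0" using assms by (simp add: is_min_poly_def)
  finally show False using ne by (metis leading_coeff_0_iff)
qed

text \<open>The existence of the minimal polynomial makes a totally real number algebraic.\<close>

definition totally_real :: "complex \<Rightarrow> bool" where
  "totally_real x \<longleftrightarrow> (\<exists>p. is_min_poly p x \<and> (\<forall>z::complex. poly (map_poly of_rat p) z = 0 \<longrightarrow> z \<in> \<real>))"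

definition Q_tr :: "complex set" where
  "Q_tr = {x. totally_real x}"

definition is_subfield :: "complex set \<Rightarrow> bool" where
  "is_subfield F \<longleftrightarrow> 0 \<in> F \<and> 1 \<in> F \<and>
     (\<forall>x\<in>F. \<forall>y\<in>F. x + y \<in> F \<and> x * y \<in> F) \<and>
     (\<forall>x\<in>F. - x \<in> F \<and> inverse x \<in> F)"

definition Q_tr_i :: "complex set" where
  "Q_tr_i = is_subfield hull (insert \<i> Q_tr)"

lemma is_subfield_Q_tr_i: "is_subfield Q_tr_i"
  unfolding Q_tr_i_def by (rule hull_in) (auto simp: is_subfield_def)

definition ring_of_integers :: "complex set \<Rightarrow> complex set" where
  "ring_of_integers K = {x \<in> K. algebraic_int x}"

abbreviation Z_tr :: "complex set" where
  "Z_tr \<equiv> ring_of_integers Q_tr"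

section \<open>The first-order language of rings\<close>

datatype ring_term =
    Var nat
  | Zero
  | One
  | Add ring_term ring_term
  | Minus ring_term
  | Mult ring_term ring_term

datatype ring_form =
    Eq ring_term ring_term
  | Neg ring_form
  | And ring_form ring_form
  | Or ring_form ring_form
  | Implies ring_form ring_form
  | Exists nat ring_form
  | Forall nat ring_form

fun term_val :: "(nat \<Rightarrow> 'a::comm_ring_1) \<Rightarrow> ring_term \<Rightarrow> 'a" where
  "term_val e (Var n) = e n"
| "term_val e Zero = 0"
| "term_val e One = 1"
| "term_val e (Add s t) = term_val e s + term_val e t"
| "term_val e (Minus t) = - term_val e t"
| "term_val e (Mult s t) = term_val e s * term_val e t"

text \<open>\<open>sat R e \<phi>\<close>: the formula \<open>\<phi>\<close> holds in the subring \<open>R\<close> of the ambient type under the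
  assignment \<open>e\<close>, which is meant to take values in \<open>R\<close>.\<close>

fun sat :: "'a::comm_ring_1 set \<Rightarrow> (nat \<Rightarrow> 'a) \<Rightarrow> ring_form \<Rightarrow> bool" where
  "sat R e (Eq s t) \<longleftrightarrow> term_val e s = term_val e t"
| "sat R e (Neg \<phi>) \<longleftrightarrow> \<not> sat R e \<phi>"
| "sat R e (And \<phi> \<psi>) \<longleftrightarrow> sat R e \<phi> \<and> sat R e \<psi>"
| "sat R e (Or \<phi> \<psi>) \<longleftrightarrow> sat R e \<phi> \<or> sat R e \<psi>"
| "sat R e (Implies \<phi> \<psi>) \<longleftrightarrow> (sat R e \<phi> \<longrightarrow> sat R e \<psi>)"
| "sat R e (Exists n \<phi>) \<longleftrightarrow> (\<exists>x\<in>R. sat R (e(n := x)) \<phi>)"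
| "sat R e (Forall n \<phi>) \<longleftrightarrow> (\<forall>x\<in>R. sat R (e(n := x)) \<phi>)"

fun term_vars :: "ring_term \<Rightarrow> nat set" where
  "term_vars (Var n) = {n}"
| "term_vars Zero = {}"
| "term_vars One = {}"
| "term_vars (Add s t) = term_vars s \<union> term_vars t"
| "term_vars (Minus t) = term_vars t"
| "term_vars (Mult s t) = term_vars s \<union> term_vars t"

fun free_vars :: "ring_form \<Rightarrow> nat set" where
  "free_vars (Eq s t) = term_vars s \<union> term_vars t"
| "free_vars (Neg \<phi>) = free_vars \<phi>"
| "free_vars (And \<phi> \<psi>) = free_vars \<phi> \<union> free_vars \<psi>"
| "free_vars (Or \<phi> \<psi>) = free_vars \<phi> \<union> free_vars \<psi>"
| "free_vars (Implies \<phi> \<psi>) = free_vars \<phi> \<union> free_vars \<psi>"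
| "free_vars (Exists n \<phi>) = free_vars \<phi> - {n}"
| "free_vars (Forall n \<phi>) = free_vars \<phi> - {n}"

fun quantifier_free :: "ring_form \<Rightarrow> bool" where
  "quantifier_free (Eq s t) \<longleftrightarrow> True"
| "quantifier_free (Neg \<phi>) \<longleftrightarrow> quantifier_free \<phi>"
| "quantifier_free (And \<phi> \<psi>) \<longleftrightarrow> quantifier_free \<phi> \<and> quantifier_free \<psi>"
| "quantifier_free (Or \<phi> \<psi>) \<longleftrightarrow> quantifier_free \<phi> \<and> quantifier_free \<psi>"
| "quantifier_free (Implies \<phi> \<psi>) \<longleftrightarrow> quantifier_free \<phi> \<and> quantifier_free \<psi>"
| "quantifier_free (Exists n \<phi>) \<longleftrightarrow> False"
| "quantifier_free (Forall n \<phi>) \<longleftrightarrow> False"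

inductive existential :: "ring_form \<Rightarrow> bool" where
  existential_qf: "quantifier_free \<phi> \<Longrightarrow> existential \<phi>"
| existential_Exists: "existential \<phi> \<Longrightarrow> existential (Exists n \<phi>)"

lemma term_val_cong:
  "(\<And>n. n \<in> term_vars t \<Longrightarrow> e n = e' n) \<Longrightarrow> term_val e t = term_val e' t"
proof (induction t)
  case (Add s t)
  have "term_val e s = term_val e' s" by (rule Add.IH(1)) (rule Add.prems, simp)
  moreover have "term_val e t = term_val e' t" by (rule Add.IH(2)) (rule Add.prems, simp)
  ultimately show ?case by simp
next
  case (Mult s t)
  have "term_val e s = term_val e' s" by (rule Mult.IH(1)) (rule Mult.prems, simp)
  moreover have "term_val e t = term_val e' t" by (rule Mult.IH(2)) (rule Mult.prems, simp)
  ultimately show ?case by simp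
qed simp_all

lemma sat_cong:
  "(\<And>n. n \<in> free_vars \<phi> \<Longrightarrow> e n = e' n) \<Longrightarrow> sat R e \<phi> = sat R e' \<phi>"
proof (induction \<phi> arbitrary: e e')
  case (Eq s t)
  have "term_val e s = term_val e' s" by (rule term_val_cong) (rule Eq.prems, simp)
  moreover have "term_val e t = term_val e' t" by (rule term_val_cong) (rule Eq.prems, simp)
  ultimately show ?case by simp
next
  case (Neg \<phi>)
  have "sat R e \<phi> = sat R e' \<phi>" by (rule Neg.IH) (rule Neg.prems, simp)
  then show ?case by simp
next
  case (And \<phi> \<psi>)
  have "sat R e \<phi> = sat R e' \<phi>" by (rule And.IH(1)) (rule And.prems, simp)
  moreover have "sat R e \<psi> = sat R e' \<psi>" by (rule And.IH(2)) (rule And.prems, simp)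
  ultimately show ?case by simp
next
  case (Or \<phi> \<psi>)
  have "sat R e \<phi> = sat R e' \<phi>" by (rule Or.IH(1)) (rule Or.prems, simp)
  moreover have "sat R e \<psi> = sat R e' \<psi>" by (rule Or.IH(2)) (rule Or.prems, simp)
  ultimately show ?case by simp
next
  case (Implies \<phi> \<psi>)
  have "sat R e \<phi> = sat R e' \<phi>" by (rule Implies.IH(1)) (rule Implies.prems, simp)
  moreover have "sat R e \<psi> = sat R e' \<psi>" by (rule Implies.IH(2)) (rule Implies.prems, simp)
  ultimately show ?case by simp
next
  case (Exists n \<phi>)
  have "sat R (e(n := x)) \<phi> = sat R (e'(n := x)) \<phi>" for x
  proof (rule Exists.IH)
    fix m assume "m \<in> free_vars \<phi>"
    then show "(e(n := x)) m = (e'(n := x)) m" using Exists.prems[of m] by (cases "m = n") simp_all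
  qed
  then show ?case by simp
next
  case (Forall n \<phi>)
  have "sat R (e(n := x)) \<phi> = sat R (e'(n := x)) \<phi>" for x
  proof (rule Forall.IH)
    fix m assume "m \<in> free_vars \<phi>"
    then show "(e(n := x)) m = (e'(n := x)) m" using Forall.prems[of m] by (cases "m = n") simp_all
  qed
  then show ?case by simp
qed

text \<open>Definability is without parameters: the defining formula has at most the free variable
  \<open>Var 0\<close>, so only the value of the assignment \<open>\<lambda>_. x\<close> at \<open>0\<close> matters.\<close>

definition existentially_definable_in :: "'a::comm_ring_1 set \<Rightarrow> 'a set \<Rightarrow> bool" where
  "existentially_definable_in R S \<longleftrightarrow>
     (\<exists>\<phi>. existential \<phi> \<and> free_vars \<phi> \<subseteq> {0} \<and> S = {x \<in> R. sat R (\<lambda>_. x) \<phi>})"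

text \<open>By \<open>sat_cong\<close> the assignment is irrelevant for sentences.\<close>

definition first_order_theory :: "'a::comm_ring_1 set \<Rightarrow> ring_form set" where
  "first_order_theory R = {\<phi>. free_vars \<phi> = {} \<and> sat R (\<lambda>_. 0) \<phi>}"

section \<open>Decidability\<close>

text \<open>Descriptions of partial recursive functions. Arities are not recorded in the syntax:
  \<open>rec_eval f xs y\<close> says that \<open>f\<close>, read as a function of \<open>length xs\<close> arguments, has value \<open>y\<close> at \<open>xs\<close>.\<close>

datatype rec_fun =
    RZero
  | RSucc
  | RProj nat
  | RComp rec_fun "rec_fun list"
  | RPrim rec_fun rec_fun
  | RMin rec_fun

inductive rec_eval :: "rec_fun \<Rightarrow> nat list \<Rightarrow> nat \<Rightarrow> bool" where
  eval_Zero: "rec_eval RZero xs 0"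
| eval_Succ: "rec_eval RSucc [x] (Suc x)"
| eval_Proj: "i < length xs \<Longrightarrow> rec_eval (RProj i) xs (xs ! i)"
| eval_Comp: "list_all2 (\<lambda>g y. rec_eval g xs y) gs ys \<Longrightarrow> rec_eval f ys z \<Longrightarrow>
    rec_eval (RComp f gs) xs z"
| eval_Prim_0: "rec_eval f xs y \<Longrightarrow> rec_eval (RPrim f g) (0 # xs) y"
| eval_Prim_Suc: "rec_eval (RPrim f g) (n # xs) r \<Longrightarrow> rec_eval g (n # r # xs) y \<Longrightarrow>
    rec_eval (RPrim f g) (Suc n # xs) y"
| eval_Min: "rec_eval f (n # xs) 0 \<Longrightarrow> (\<forall>m<n. \<exists>k. rec_eval f (m # xs) (Suc k)) \<Longrightarrow>
    rec_eval (RMin f) xs n"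

inductive_cases eval_ZeroE: "rec_eval RZero xs y"
inductive_cases eval_SuccE: "rec_eval RSucc xs y"
inductive_cases eval_ProjE: "rec_eval (RProj i) xs y"
inductive_cases eval_CompE: "rec_eval (RComp f gs) xs y"
inductive_cases eval_Prim_0E: "rec_eval (RPrim f g) (0 # xs) y"
inductive_cases eval_Prim_SucE: "rec_eval (RPrim f g) (Suc n # xs) y"
inductive_cases eval_MinE: "rec_eval (RMin f) xs y"

lemma rec_eval_deterministic:
  "rec_eval f xs y \<Longrightarrow> rec_eval f xs z \<Longrightarrow> y = z"
proof (induction arbitrary: z rule: rec_eval.induct)
  case (eval_Comp xs gs ys f y)
  from eval_Comp.prems obtain zs where
    zs: "list_all2 (\<lambda>g y. rec_eval g xs y) gs zs" "rec_eval f zs z"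
    by (auto elim: eval_CompE)
  have len: "length ys = length gs" "length zs = length gs"
    using eval_Comp.IH(1) zs(1) by (auto dest: list_all2_lengthD)
  have "ys ! i = zs ! i" if "i < length gs" for i
    using list_all2_nthD[OF eval_Comp.IH(1) that] list_all2_nthD[OF zs(1) that] by blast
  hence "ys = zs" using len by (simp add: nth_equalityI)
  then show ?case using eval_Comp.IH(2) zs(2) by blast
next
  case (eval_Min f n xs)
  from eval_Min.prems have z: "rec_eval f (z # xs) 0" "\<forall>m<z. \<exists>k. rec_eval f (m # xs) (Suc k)"
    by (auto elim: eval_MinE)
  show ?case
  proof (cases n z rule: linorder_cases)
    case less
    then obtain k where "rec_eval f (n # xs) (Suc k)" using z(2) by blast
    then have "0 = Suc k" by (rule eval_Min.IH(1))
    then show ?thesis by simp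
  next
    case greater
    then obtain k where "\<forall>x. rec_eval f (z # xs) x \<longrightarrow> Suc k = x"
      using eval_Min.IH(2) by blast
    then have "Suc k = 0" using z(1) by blast
    then show ?thesis by simp
  qed simp
next
  case (eval_Prim_Suc f g n xs r y)
  from eval_Prim_Suc.prems obtain r' where
    "rec_eval (RPrim f g) (n # xs) r'" "rec_eval g (n # r' # xs) z"
    by (rule eval_Prim_SucE)
  then show ?case using eval_Prim_Suc.IH by metis
next
  case (eval_Zero xs)
  then show ?case by (auto elim: eval_ZeroE)
next
  case (eval_Succ x)
  then show ?case by (auto elim: eval_SuccE)
next
  case (eval_Proj i xs)
  then show ?case by (auto elim: eval_ProjE)
next
  case (eval_Prim_0 f xs y g)
  from eval_Prim_0.prems have "rec_eval f xs z"
    by (rule eval_Prim_0E)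
  then show ?case by (rule eval_Prim_0.IH)
qed

definition decidable :: "nat set \<Rightarrow> bool" where
  "decidable A \<longleftrightarrow> (\<exists>f. \<forall>n. rec_eval f [n] (if n \<in> A then 1 else 0))"

text \<open>Goedel numbers; \<open>prod_encode\<close> is the Cantor pairing function.\<close>

fun term_code :: "ring_term \<Rightarrow> nat" where
  "term_code (Var n) = prod_encode (0, n)"
| "term_code Zero = prod_encode (1, 0)"
| "term_code One = prod_encode (2, 0)"
| "term_code (Add s t) = prod_encode (3, prod_encode (term_code s, term_code t))"
| "term_code (Minus t) = prod_encode (4, term_code t)"
| "term_code (Mult s t) = prod_encode (5, prod_encode (term_code s, term_code t))"

fun form_code :: "ring_form \<Rightarrow> nat" where
  "form_code (Eq s t) = prod_encode (0, prod_encode (term_code s, term_code t))"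
| "form_code (Neg \<phi>) = prod_encode (1, form_code \<phi>)"
| "form_code (And \<phi> \<psi>) = prod_encode (2, prod_encode (form_code \<phi>, form_code \<psi>))"
| "form_code (Or \<phi> \<psi>) = prod_encode (3, prod_encode (form_code \<phi>, form_code \<psi>))"
| "form_code (Implies \<phi> \<psi>) = prod_encode (4, prod_encode (form_code \<phi>, form_code \<psi>))"
| "form_code (Exists n \<phi>) = prod_encode (5, prod_encode (n, form_code \<phi>))"
| "form_code (Forall n \<phi>) = prod_encode (6, prod_encode (n, form_code \<phi>))"

lemma term_code_inj: "term_code s = term_code t \<Longrightarrow> s = t"
proof (induction s arbitrary: t)
  case (Var n) then show ?case by (cases t) auto
next
  case Zero then show ?case by (cases t) auto
next
  case One then show ?case by (cases t) auto
next
  case (Add a b) then show ?case by (cases t) auto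
next
  case (Minus a) then show ?case by (cases t) auto
next
  case (Mult a b) then show ?case by (cases t) auto
qed

lemma form_code_inj: "form_code \<phi> = form_code \<psi> \<Longrightarrow> \<phi> = \<psi>"
proof (induction \<phi> arbitrary: \<psi>)
  case (Eq s t) then show ?case by (cases \<psi>) (auto dest: term_code_inj)
next
  case (Neg a) then show ?case by (cases \<psi>) auto
next
  case (And a b) then show ?case by (cases \<psi>) auto
next
  case (Or a b) then show ?case by (cases \<psi>) auto
next
  case (Implies a b) then show ?case by (cases \<psi>) auto
next
  case (Exists n a) then show ?case by (cases \<psi>) auto
next
  case (Forall n a) then show ?case by (cases \<psi>) auto
qed

definition decidable_theory :: "ring_form set \<Rightarrow> bool" where
  "decidable_theory T \<longleftrightarrow> decidable (form_code ` T)"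

end

theory Submission
  imports
    Defs
    "Jordan_Normal_Form.Char_Poly"
    "HOL-Number_Theory.Cong"
begin

text \<open>Let \<open>O\<close> be the ring of integers of \<open>\<rat>\<^sup>t\<^sup>r(\<i>)\<close>. Complex conjugation commutes with every embedding of
  this field, so for a unit \<open>t\<close> of \<open>O\<close> all conjugates of \<open>t / cnj t\<close> lie on the unit circle. If
  \<open>t = 1 + 3 g\<close>, then \<open>t / cnj t - 1 = 3 \<beta>\<close> with an algebraic integer \<open>\<beta>\<close> all of whose conjugates are
  smaller than 1, hence \<open>\<beta> = 0\<close> and \<open>t\<close> is real. Conversely, for every totally real integer \<open>x\<close> the
  equation \<open>g\<^sup>2 = 4 x\<^sup>2 (1 + 3 g)\<close> has a solution making \<open>1 + 3 g\<close> a unit; imposing it for \<open>x\<close> and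
  \<open>x + 1\<close> characterizes the real elements of \<open>O\<close>.

  Roots of unity are then definable by Kronecker's theorem, and \<open>y \<in> O\<close> is a rational integer iff
  for every root of unity \<open>z \<noteq> 1\<close> there is a root of unity \<open>u\<close> with
  \<open>u - 1 \<equiv> y (z - 1)\<close> modulo \<open>(z - 1)\<^sup>2\<close>: taking \<open>z\<close> of prime order \<open>p\<close> forces \<open>u\<close> to be a power of
  \<open>z\<close>, so \<open>y\<close> and all its conjugates are congruent to one integer modulo \<open>z - 1\<close>, for every \<open>p\<close>.
  Thus the natural numbers are definable in \<open>O\<close>, and arithmetic is undecidable by diagonalization.\<close>

section \<open>Integral elements\<close>

text \<open>The constant 3 is the least integer above 2: points of the unit circle are at distance
  at most 2, so a third of their difference is smaller than 1 at every embedding. The equation for g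
  comes from a unit. With s = 3 x + sqrt (9 x^2 + 1) one has s (s - 6 x) = 1 and s^2 = 1 + 6 x s;
  thus t = s^2 is a unit 1 + 3 g with g = 2 x s, and eliminating s leaves g^2 = 4 x^2 (1 + 3 g). A
  solution g determines only x^2, whence the second copy at x + 1. Modulo z - 1 all powers of z are
  1; the modulus (z - 1)^2 is what retains the exponent. The obstacle is that O contains roots of
  unity of every order: it has to be excluded that some u outside the p-th roots of unity is
  congruent to 1 modulo z - 1. Conjugates are taken by homomorphisms defined on all algebraic
  numbers at once, obtained from Zorn's lemma, so that no splitting field or Galois group has to be
  chosen for particular elements.\<close>

locale integrality = comm_ring_hom hom for hom :: "'a::comm_ring_1 \<Rightarrow> 'b::field"
begin

text \<open>Over \<open>int\<close> this is being an algebraic integer, over \<open>rat\<close>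
  being algebraic; one proof of closure under sums and products serves both.\<close>

definition integral :: "'b \<Rightarrow> bool" where
  "integral z \<longleftrightarrow> (\<exists>p. lead_coeff p = 1 \<and> poly (map_poly hom p) z = 0)"

definition lin_span :: "'b set \<Rightarrow> 'b set" where
  "lin_span B = {z. \<exists>c. z = (\<Sum>b\<in>B. hom (c b) * b)}"

lemma lin_span_0: "0 \<in> lin_span B"
  unfolding lin_span_def by (auto intro!: exI[of _ "\<lambda>_. 0"])

lemma lin_span_add: "y \<in> lin_span B \<Longrightarrow> z \<in> lin_span B \<Longrightarrow> y + z \<in> lin_span B"
proof -
  assume "y \<in> lin_span B" "z \<in> lin_span B"
  then obtain c d where "y = (\<Sum>b\<in>B. hom (c b) * b)" "z = (\<Sum>b\<in>B. hom (d b) * b)"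
    unfolding lin_span_def by blast
  then have "y + z = (\<Sum>b\<in>B. hom (c b + d b) * b)"
    by (simp add: hom_add distrib_right sum.distrib)
  then show ?thesis unfolding lin_span_def by (auto intro!: exI[of _ "\<lambda>b. c b + d b"])
qed

lemma lin_span_scale: "z \<in> lin_span B \<Longrightarrow> hom r * z \<in> lin_span B"
proof -
  assume "z \<in> lin_span B"
  then obtain c where "z = (\<Sum>b\<in>B. hom (c b) * b)"
    unfolding lin_span_def by blast
  then have "hom r * z = (\<Sum>b\<in>B. hom (r * c b) * b)"
    by (simp add: hom_mult sum_distrib_left mult_ac)
  then show ?thesis unfolding lin_span_def by (auto intro!: exI[of _ "\<lambda>b. r * c b"])
qed

lemma lin_span_superset: "finite B \<Longrightarrow> b \<in> B \<Longrightarrow> b \<in> lin_span B"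
proof -
  assume "finite B" "b \<in> B"
  have "hom (if x = b then 1 else 0) * x = (if x = b then x else 0)" for x
    by (cases "x = b") simp_all
  then have "(\<Sum>x\<in>B. hom (if x = b then 1 else 0) * x) = b"
    using \<open>finite B\<close> \<open>b \<in> B\<close> by simp
  then have "b = (\<Sum>x\<in>B. hom (if x = b then 1 else 0) * x)" by (rule sym)
  then show ?thesis unfolding lin_span_def by (intro CollectI exI[of _ "\<lambda>x. if x = b then 1 else 0"])
qed

lemma lin_span_sum: "(\<And>i. i \<in> I \<Longrightarrow> f i \<in> lin_span B) \<Longrightarrow> (\<Sum>i\<in>I. f i) \<in> lin_span B"
  by (induction I rule: infinite_finite_induct) (auto intro: lin_span_0 lin_span_add)

lemma lin_span_mult:
  assumes "x \<in> lin_span A" "y \<in> lin_span B" "finite A" "finite B"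
  shows "x * y \<in> lin_span {a * b | a b. a \<in> A \<and> b \<in> B}"
proof -
  let ?C = "{a * b | a b. a \<in> A \<and> b \<in> B}"
  have fin: "finite ?C" using assms(3,4) by (intro finite_image_set2) auto
  obtain c d where "x = (\<Sum>a\<in>A. hom (c a) * a)" "y = (\<Sum>b\<in>B. hom (d b) * b)"
    using assms unfolding lin_span_def by blast
  then have "x * y = (\<Sum>a\<in>A. \<Sum>b\<in>B. hom (c a * d b) * (a * b))"
    by (simp add: sum_product hom_mult mult_ac)
  also have "\<dots> \<in> lin_span ?C"
    by (intro lin_span_sum lin_span_scale lin_span_superset[OF fin]) auto
  finally show ?thesis .
qed

text \<open>Multiplication by \<open>z\<close> acts on the finite family \<open>B\<close> by a matrix with coefficients in the
  base ring, so \<open>z\<close> is a root of its characteristic polynomial.\<close>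

lemma integral_of_lin_span:
  assumes "finite B" "1 \<in> B" "\<And>b. b \<in> B \<Longrightarrow> z * b \<in> lin_span B"
  shows "integral z"
proof -
  obtain bs where bs: "set bs = B" "distinct bs" using assms(1) finite_distinct_list by blast
  define n where "n = length bs"
  have "\<forall>b\<in>B. \<exists>c. z * b = (\<Sum>b'\<in>B. hom (c b') * b')"
    using assms(3) unfolding lin_span_def by blast
  then obtain c where c: "\<And>b. b \<in> B \<Longrightarrow> z * b = (\<Sum>b'\<in>B. hom (c b b') * b')" by metis
  define A where "A = mat n n (\<lambda>(i, j). c (bs ! i) (bs ! j))"
  define v where "v = vec n (\<lambda>i. bs ! i)"
  have A: "A \<in> carrier_mat n n" by (simp add: A_def)
  have mA: "map_mat hom A \<in> carrier_mat n n" using A by simp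
  have "map_mat hom A *\<^sub>v v = z \<cdot>\<^sub>v v"
  proof (rule eq_vecI)
    fix i assume "i < dim_vec (z \<cdot>\<^sub>v v)"
    then have i: "i < n" by (simp add: v_def)
    have "(map_mat hom A *\<^sub>v v) $ i = (\<Sum>j<n. hom (c (bs ! i) (bs ! j)) * bs ! j)"
      using i by (simp add: A_def v_def scalar_prod_def lessThan_atLeast0)
    also have "\<dots> = (\<Sum>b'\<in>B. hom (c (bs ! i) b') * b')"
      by (rule sum.reindex_bij_betw) (use bs bij_betw_nth[OF bs(2)] n_def in auto)
    also have "\<dots> = z * bs ! i" using c[of "bs ! i"] i bs n_def by (metis nth_mem)
    finally show "(map_mat hom A *\<^sub>v v) $ i = (z \<cdot>\<^sub>v v) $ i" using i by (simp add: v_def)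
  qed (simp add: A_def v_def)
  \<comment> \<open>The entry 1 is what makes the candidate eigenvector nonzero.\<close>
  moreover obtain k where "k < n" "bs ! k = 1" using assms(2) bs n_def by (metis in_set_conv_nth)
  then have "v \<noteq> 0\<^sub>v n" by (auto simp: v_def vec_eq_iff)
  ultimately have "eigenvalue (map_mat hom A) z"
    using mA unfolding eigenvalue_def eigenvector_def by (auto simp: v_def intro!: exI[of _ v])
  then have "poly (map_poly hom (char_poly A)) z = 0"
    using eigenvalue_root_char_poly[OF mA] char_poly_hom[OF A] by simp
  then show ?thesis unfolding integral_def using degree_monic_char_poly[OF A] by auto
qed

text \<open>The powers of \<open>x\<close> below the degree of a monic polynomial suffice: only the
  top product leaves the family, and the polynomial rewrites it. A monic constant has no root, so
  the power 1 is among them.\<close>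

lemma integral_imp_lin_span:
  assumes "integral x"
  shows "\<exists>P. finite P \<and> 1 \<in> P \<and> (\<forall>b\<in>P. x * b \<in> lin_span P)"
proof -
  obtain p where p: "lead_coeff p = 1" "poly (map_poly hom p) x = 0"
    using assms unfolding integral_def by blast
  define n where "n = degree p"
  define P where "P = (\<lambda>i. x ^ i) ` {..<n}"
  have deg: "degree (map_poly hom p) = n"
    unfolding n_def using p(1) by (intro degree_map_poly) (metis coeff_0 hom_one hom_zero zero_neq_one)
  have sum: "(\<Sum>i\<le>n. hom (coeff p i) * x ^ i) = 0"
    using p(2) unfolding poly_altdef deg by (simp add: coeff_map_poly)
  have cn: "coeff p n = 1" using p(1) n_def by simp
  have "n \<noteq> 0" using sum cn by (intro notI) simp
  then have "1 \<in> P" unfolding P_def by (force intro: image_eqI[of _ _ 0])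
  moreover have fin: "finite P" by (simp add: P_def)
  moreover have "x * b \<in> lin_span P" if "b \<in> P" for b
  proof -
    obtain i where i: "i < n" "b = x ^ i" using \<open>b \<in> P\<close> by (auto simp: P_def)
    show ?thesis
    proof (cases "Suc i = n")
      case False
      then have "x ^ Suc i \<in> P" using i unfolding P_def by (intro imageI) auto
      then show ?thesis using i lin_span_superset[OF fin] by simp
    next
      case True
      have eq: "(\<Sum>i\<le>n. hom (coeff p i) * x ^ i) = x ^ n + (\<Sum>i<n. hom (coeff p i) * x ^ i)"
        unfolding lessThan_Suc_atMost[symmetric] by (simp add: cn)
      have "x * b = x ^ n" using i True by auto
      also have "\<dots> = - (\<Sum>i<n. hom (coeff p i) * x ^ i)"
        using eq unfolding sum by (metis add.inverse_inverse add_eq_0_iff)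
      also have "\<dots> = hom (-1) * (\<Sum>i<n. hom (coeff p i) * x ^ i)"
        by (simp add: hom_uminus)
      also have "\<dots> \<in> lin_span P"
        by (intro lin_span_scale lin_span_sum lin_span_superset[OF fin]) (auto simp: P_def)
      finally show ?thesis .
    qed
  qed
  ultimately show ?thesis by blast
qed

text \<open>The products of two stable families span a module stable under multiplication by
  \<open>x\<close> and by \<open>y\<close>, hence by \<open>x + y\<close> and
  \<open>x * y\<close>.\<close>

lemma integral_add_mult:
  assumes "integral x" "integral y"
  shows "integral (x + y) \<and> integral (x * y)"
proof -
  obtain P where P: "finite P" "1 \<in> P" "\<And>b. b \<in> P \<Longrightarrow> x * b \<in> lin_span P"
    using integral_imp_lin_span[OF assms(1)] by blast
  obtain Q where Q: "finite Q" "1 \<in> Q" "\<And>b. b \<in> Q \<Longrightarrow> y * b \<in> lin_span Q"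
    using integral_imp_lin_span[OF assms(2)] by blast
  define B where "B = {a * b | a b. a \<in> P \<and> b \<in> Q}"
  have fin: "finite B" unfolding B_def using P Q by (intro finite_image_set2) auto
  have one: "1 \<in> B" unfolding B_def using P(2) Q(2) by force
  have mult: "u * w \<in> lin_span B" if "u \<in> lin_span P" "w \<in> lin_span Q" for u w
    unfolding B_def by (rule lin_span_mult) (use that P Q in auto)
  have "(x + y) * t \<in> lin_span B \<and> (x * y) * t \<in> lin_span B" if t: "t \<in> B" for t
  proof -
    obtain a b where ab: "t = a * b" "a \<in> P" "b \<in> Q" using t by (auto simp: B_def)
    have sp: "a \<in> lin_span P" "b \<in> lin_span Q" using ab P Q lin_span_superset by auto
    have "(x + y) * t = (x * a) * b + a * (y * b)" "(x * y) * t = (x * a) * (y * b)"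
      using ab by (auto simp: algebra_simps)
    moreover have "(x * a) * b \<in> lin_span B" "a * (y * b) \<in> lin_span B" "(x * a) * (y * b) \<in> lin_span B"
      using mult sp P(3) Q(3) ab by blast+
    ultimately show ?thesis by (metis lin_span_add)
  qed
  then show ?thesis using integral_of_lin_span[OF fin one] by blast
qed

end

section \<open>Algebraic integers and algebraic numbers under ring operations\<close>

interpretation int_integrality: integrality "of_int :: int \<Rightarrow> complex" ..
interpretation rat_integrality: integrality "of_rat :: rat \<Rightarrow> complex" ..

lemma algebraic_int_iff_integral:
  "algebraic_int (x::complex) \<longleftrightarrow> int_integrality.integral x"
  unfolding algebraic_int_altdef_ipoly int_integrality.integral_def by blast

lemma algebraic_int_add [intro]: "algebraic_int x \<Longrightarrow> algebraic_int y \<Longrightarrow> algebraic_int (x + y :: complex)"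
  unfolding algebraic_int_iff_integral using int_integrality.integral_add_mult by blast

lemma algebraic_int_mult [intro]: "algebraic_int x \<Longrightarrow> algebraic_int y \<Longrightarrow> algebraic_int (x * y :: complex)"
  unfolding algebraic_int_iff_integral using int_integrality.integral_add_mult by blast

lemma algebraic_int_diff [intro]: "algebraic_int x \<Longrightarrow> algebraic_int y \<Longrightarrow> algebraic_int (x - y :: complex)"
  using algebraic_int_add[of x "- y"] by auto

lemma algebraic_iff_of_rat_poly:
  "algebraic (x::complex) \<longleftrightarrow> (\<exists>p. p \<noteq> 0 \<and> poly (map_poly of_rat p) x = 0)"
proof
  assume "algebraic x"
  then obtain p where p: "p \<noteq> 0" "poly (map_poly of_int p) x = 0" by (rule algebraicE')
  then have "map_poly of_rat (map_poly of_int p) = (map_poly of_int p :: complex poly)"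
    by (intro poly_eqI) (simp add: coeff_map_poly)
  with p show "\<exists>p. p \<noteq> 0 \<and> poly (map_poly of_rat p) x = 0"
    by (intro exI[of _ "map_poly of_int p"]) auto
next
  assume "\<exists>p. p \<noteq> 0 \<and> poly (map_poly of_rat p) x = 0"
  then obtain p where p: "p \<noteq> 0" "poly (map_poly of_rat p) x = 0" by blast
  show "algebraic x"
    by (rule algebraicI'[of "map_poly of_rat p"]) (use p in \<open>auto simp: coeff_map_poly\<close>)
qed

lemma algebraic_iff_integral:
  "algebraic (x::complex) \<longleftrightarrow> rat_integrality.integral x"
proof
  assume "algebraic x"
  then obtain p where p: "p \<noteq> 0" "poly (map_poly of_rat p) x = 0"
    unfolding algebraic_iff_of_rat_poly by blast
  from p(2) have "poly (map_poly of_rat (Polynomial.smult (inverse (lead_coeff p)) p)) x = 0"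
    by (simp add: of_rat_hom.map_poly_hom_smult)
  moreover have "lead_coeff (Polynomial.smult (inverse (lead_coeff p)) p) = 1" using p by simp
  ultimately show "rat_integrality.integral x" unfolding rat_integrality.integral_def by blast
next
  assume "rat_integrality.integral x"
  then show "algebraic x" unfolding rat_integrality.integral_def algebraic_iff_of_rat_poly
    by (metis coeff_0 zero_neq_one)
qed

lemma algebraic_add [intro]: "algebraic x \<Longrightarrow> algebraic y \<Longrightarrow> algebraic (x + y :: complex)"
  unfolding algebraic_iff_integral using rat_integrality.integral_add_mult by blast

lemma algebraic_mult [intro]: "algebraic x \<Longrightarrow> algebraic y \<Longrightarrow> algebraic (x * y :: complex)"
  unfolding algebraic_iff_integral using rat_integrality.integral_add_mult by blast

section \<open>Homomorphisms from the algebraic numbers\<close>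

interpretation of_rat_poly: map_poly_comm_ring_hom "of_rat :: rat \<Rightarrow> complex" ..

text \<open>Graphs of ring homomorphisms into \<open>\<complex>\<close> defined on a subring of the algebraic numbers;
  algebraicity makes them injective.\<close>

definition partial_emb :: "(complex \<times> complex) set \<Rightarrow> bool" where
  "partial_emb G \<longleftrightarrow> (1, 1) \<in> G \<and>
     (\<forall>a b c d. (a, b) \<in> G \<longrightarrow> (c, d) \<in> G \<longrightarrow> (a + c, b + d) \<in> G \<and> (a * c, b * d) \<in> G) \<and>
     (\<forall>a b. (a, b) \<in> G \<longrightarrow> (- a, - b) \<in> G) \<and>
     (\<forall>b. (0, b) \<in> G \<longrightarrow> b = 0) \<and> (\<forall>a b. (a, b) \<in> G \<longrightarrow> algebraic a)"

lemma partial_embD: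
  assumes "partial_emb G"
  shows "(1, 1) \<in> G" "(a, b) \<in> G \<Longrightarrow> (c, d) \<in> G \<Longrightarrow> (a + c, b + d) \<in> G"
    "(a, b) \<in> G \<Longrightarrow> (c, d) \<in> G \<Longrightarrow> (a * c, b * d) \<in> G"
    "(a, b) \<in> G \<Longrightarrow> (- a, - b) \<in> G" "(0, b) \<in> G \<Longrightarrow> b = 0" "(a, b) \<in> G \<Longrightarrow> algebraic a"
proof -
  note * = assms[unfolded partial_emb_def]
  show "(1, 1) \<in> G" using * by (rule conjunct1)
  show "(a, b) \<in> G \<Longrightarrow> (c, d) \<in> G \<Longrightarrow> (a + c, b + d) \<in> G"
    "(a, b) \<in> G \<Longrightarrow> (c, d) \<in> G \<Longrightarrow> (a * c, b * d) \<in> G"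
    using *[THEN conjunct2, THEN conjunct1] by blast+
  show "(a, b) \<in> G \<Longrightarrow> (- a, - b) \<in> G"
    using *[THEN conjunct2, THEN conjunct2, THEN conjunct1] by blast
  show "(0, b) \<in> G \<Longrightarrow> b = 0" "(a, b) \<in> G \<Longrightarrow> algebraic a"
    using *[THEN conjunct2, THEN conjunct2, THEN conjunct2] by blast+
qed

lemma partial_emb_0: "partial_emb G \<Longrightarrow> (0, 0) \<in> G"
  using partial_embD(2)[of G 1 1 "-1" "-1"] partial_embD(1)[of G] partial_embD(4)[of G 1 1] by simp

lemma partial_emb_diff: "partial_emb G \<Longrightarrow> (a, b) \<in> G \<Longrightarrow> (c, d) \<in> G \<Longrightarrow> (a - c, b - d) \<in> G"
  using partial_embD(2)[of G a b "-c" "-d"] partial_embD(4)[of G c d] by simp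

lemma partial_emb_of_nat: "partial_emb G \<Longrightarrow> (of_nat n, of_nat n) \<in> G"
proof (induction n)
  case (Suc n)
  then show ?case using partial_embD(2)[of G 1 1 "of_nat n" "of_nat n"] partial_embD(1)[of G] by simp
qed (simp add: partial_emb_0)

lemma partial_emb_of_int: "partial_emb G \<Longrightarrow> (of_int n, of_int n) \<in> G"
proof (cases n)
  case (neg m)
  assume "partial_emb G"
  then show ?thesis using partial_embD(4) partial_emb_of_nat neg
    by (metis of_int_minus of_int_of_nat_eq)
next
  case (nonneg m)
  assume "partial_emb G"
  then show ?thesis using partial_emb_of_nat nonneg by (metis of_int_of_nat_eq)
qed

lemma partial_emb_functional: "partial_emb G \<Longrightarrow> (a, b) \<in> G \<Longrightarrow> (a, c) \<in> G \<Longrightarrow> b = c"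
  using partial_emb_diff[of G a b a c] partial_embD(5)[of G "b - c"] by simp

lemma partial_emb_poly:
  assumes "partial_emb G" "(a, b) \<in> G" "\<And>i. (coeff f i, coeff g i) \<in> G"
  shows "(poly f a, poly g b) \<in> G"
  using assms(3)
proof (induction f g rule: poly_induct2)
  case 0
  then show ?case by (simp add: partial_emb_0[OF assms(1)])
next
  case (pCons c f d g)
  have "(coeff f i, coeff g i) \<in> G" for i using pCons.prems[of "Suc i"] by simp
  then have "(poly f a, poly g b) \<in> G" by (rule pCons.IH)
  moreover have "(c, d) \<in> G" using pCons.prems[of 0] by simp
  ultimately show ?case using partial_embD(2,3)[OF assms(1)] assms(2) by simp
qed

text \<open>The domain need not be a field, so inverses cannot give injectivity. Instead an integer
  polynomial with root \<open>a\<close> and nonzero constant coefficient is transported to the image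
  0, where its value is that coefficient.\<close>

lemma partial_emb_inj:
  assumes "partial_emb G" "(a, 0) \<in> G"
  shows "a = 0"
proof (rule ccontr)
  assume "a \<noteq> 0"
  moreover have "algebraic a" using assms by (rule partial_embD(6))
  ultimately obtain p where p: "coeff p 0 \<noteq> 0" "poly (map_poly of_int p) a = 0"
    using algebraicE'_nonzero by blast
  have "(poly (map_poly of_int p) a, poly (map_poly of_int p) 0) \<in> G"
    by (rule partial_emb_poly[OF assms]) (simp add: coeff_map_poly partial_emb_of_int[OF assms(1)])
  then have "poly (map_poly of_int p) 0 = (0::complex)"
    unfolding p(2) by (rule partial_embD(5)[OF assms(1)])
  then show False using p(1) by (simp add: poly_0_coeff_0 coeff_map_poly)
qed

section \<open>Extending a partial embedding by one algebraic number\<close>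

lemma algebraic_poly:
  assumes "algebraic (a::complex)" "\<And>i. algebraic (coeff f i)"
  shows "algebraic (poly f a)"
  using assms(2)
proof (induction f)
  case (pCons c f)
  have "algebraic (coeff f i)" for i using pCons.prems[of "Suc i"] by simp
  then have "algebraic (poly f a)" by (rule pCons.IH)
  moreover have "algebraic c" using pCons.prems[of 0] by simp
  ultimately show ?case using assms(1) by auto
qed simp

text \<open>\<open>g\<close> is \<open>f\<close> with its coefficients moved by the homomorphism
  whose graph is \<open>G\<close>; carrying both along replaces applying a map to
  coefficients.\<close>

definition poly_pair :: "(complex \<times> complex) set \<Rightarrow> complex poly \<Rightarrow> complex poly \<Rightarrow> bool" where
  "poly_pair G f g \<longleftrightarrow> (\<forall>i. (coeff f i, coeff g i) \<in> G)"

context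
  fixes G
  assumes G: "partial_emb G"
begin

lemma poly_pair_0_iff: "poly_pair G f g \<Longrightarrow> coeff f i = 0 \<longleftrightarrow> coeff g i = 0"
proof -
  assume "poly_pair G f g"
  then have "(coeff f i, coeff g i) \<in> G" by (simp add: poly_pair_def)
  then show ?thesis using partial_emb_inj[OF G, of "coeff f i"] partial_embD(5)[OF G, of "coeff g i"] by auto
qed

lemma poly_pair_degree: "poly_pair G f g \<Longrightarrow> degree f = degree g"
  unfolding degree_def by (simp add: poly_pair_0_iff)

lemma poly_pair_eq_0: "poly_pair G f g \<Longrightarrow> f = 0 \<longleftrightarrow> g = 0"
  unfolding poly_eq_iff by (simp add: poly_pair_0_iff)

lemma poly_pair_add: "poly_pair G f g \<Longrightarrow> poly_pair G f' g' \<Longrightarrow> poly_pair G (f + f') (g + g')"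
  and poly_pair_diff: "poly_pair G f g \<Longrightarrow> poly_pair G f' g' \<Longrightarrow> poly_pair G (f - f') (g - g')"
  and poly_pair_uminus: "poly_pair G f g \<Longrightarrow> poly_pair G (- f) (- g)"
  unfolding poly_pair_def by (auto intro: partial_embD(2,4)[OF G] partial_emb_diff[OF G])

lemma partial_emb_sum:
  "(\<And>i. i \<in> I \<Longrightarrow> (f i, g i) \<in> G) \<Longrightarrow> (\<Sum>i\<in>I. f i, \<Sum>i\<in>I. g i) \<in> G"
proof (induction I rule: infinite_finite_induct)
  case (insert x F)
  then show ?case using partial_embD(2)[OF G] by simp
qed (use partial_emb_0[OF G] in simp_all)

lemma poly_pair_mult: "poly_pair G f g \<Longrightarrow> poly_pair G f' g' \<Longrightarrow> poly_pair G (f * f') (g * g')"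
  unfolding poly_pair_def coeff_mult by (auto intro!: partial_emb_sum partial_embD(3)[OF G])

lemma poly_pair_smult: "(a, b) \<in> G \<Longrightarrow> poly_pair G f g \<Longrightarrow> poly_pair G (Polynomial.smult a f) (Polynomial.smult b g)"
  unfolding poly_pair_def by (auto intro!: partial_embD(3)[OF G])

lemma poly_pair_monom: "(a, b) \<in> G \<Longrightarrow> poly_pair G (Polynomial.monom a n) (Polynomial.monom b n)"
  unfolding poly_pair_def by (auto simp: partial_emb_0[OF G])

lemma poly_pair_map_of_int: "poly_pair G (map_poly of_int p) (map_poly of_int p)"
  unfolding poly_pair_def by (simp add: coeff_map_poly partial_emb_of_int[OF G])

text \<open>Pseudo-division by the minimal pair \<open>(p, q)\<close> avoids inverses, so that the domain of a partial
  embedding need only be a ring.\<close>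

lemma poly_pair_root:
  assumes pq: "poly_pair G p q" "p \<noteq> 0" "poly p a = 0"
    and min: "\<And>f g. poly_pair G f g \<Longrightarrow> f \<noteq> 0 \<Longrightarrow> poly f a = 0 \<Longrightarrow> degree p \<le> degree f"
    and b: "poly q b = 0"
    and fg: "poly_pair G f g" "poly f a = 0"
  shows "poly g b = 0"
  using fg
proof (induction "degree f" arbitrary: f g rule: less_induct)
  case less
  show ?case
  proof (cases "f = 0")
    case True
    then have "g = 0" using poly_pair_eq_0[OF less.prems(1)] by simp
    then show ?thesis by simp
  next
    case False
    define m where "m = degree f - degree p"
    have le: "degree p \<le> degree f" using min less.prems False by blast
    define f1 where "f1 = Polynomial.smult (lead_coeff p) f - Polynomial.monom (lead_coeff f) m * p"
    define g1 where "g1 = Polynomial.smult (lead_coeff q) g - Polynomial.monom (lead_coeff g) m * q"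
    have dq: "degree q = degree p" "degree g = degree f"
      using poly_pair_degree pq(1) less.prems(1) by auto
    have lc: "(lead_coeff p, lead_coeff q) \<in> G" "(lead_coeff f, lead_coeff g) \<in> G"
      using pq(1) less.prems(1) dq unfolding poly_pair_def by auto
    have pair: "poly_pair G f1 g1"
      unfolding f1_def g1_def
      by (intro poly_pair_diff poly_pair_smult poly_pair_mult poly_pair_monom lc less.prems pq)
    have root: "poly f1 a = 0" by (simp add: f1_def less.prems pq)
    have "poly g1 b = 0"
    proof (cases "f1 = 0")
      case True
      then have "g1 = 0" using poly_pair_eq_0[OF pair] by simp
      then show ?thesis by simp
    next
      case False
      have "degree (Polynomial.monom (lead_coeff f) m * p) \<le> degree f"
        using degree_mult_le[of "Polynomial.monom (lead_coeff f) m" p] degree_monom_le[of "lead_coeff f" m] le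
        unfolding m_def by linarith
      then have dle: "degree f1 \<le> degree f"
        unfolding f1_def by (intro degree_diff_le) (auto intro: order.trans[OF degree_smult_le])
      have "coeff (Polynomial.monom (lead_coeff f) m * p) (degree f) = lead_coeff f * lead_coeff p"
        using le by (simp add: coeff_monom_mult m_def)
      then have "coeff f1 (degree f) = 0" by (simp add: f1_def)
      then have "degree f1 \<noteq> degree f" using False by (metis leading_coeff_0_iff)
      then have "degree f1 < degree f" using dle by simp
      then show ?thesis using less.hyps pair root by blast
    qed
    then have "lead_coeff q * poly g b = 0" by (simp add: g1_def b)
    moreover have "q \<noteq> 0" using poly_pair_eq_0[OF pq(1)] pq(2) by simp
    ultimately show ?thesis by simp
  qed
qed

text \<open>A pair \<open>(p, q)\<close> of least degree with \<open>p\<close> vanishing at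
  \<open>a\<close> acts as a minimal polynomial together with its image, and \<open>a\<close> may be
  sent to any root \<open>b\<close> of \<open>q\<close>. By \<open>poly_pair_root\<close>, sending
  \<open>poly f a\<close> to \<open>poly g b\<close> is well defined.\<close>

lemma partial_emb_extend:
  assumes a: "algebraic a"
  shows "\<exists>G' b. partial_emb G' \<and> G \<subseteq> G' \<and> (a, b) \<in> G'"
proof -
  define P where "P = (\<lambda>(p, q). poly_pair G p q \<and> p \<noteq> 0 \<and> poly p a = 0)"
  obtain p0 where "p0 \<noteq> 0" "poly (map_poly of_int p0) a = 0" using a by (rule algebraicE')
  \<comment> \<open>Partial embeddings fix the integers, so an integer polynomial is its own
    partner.\<close>
  then have ex: "P (map_poly of_int p0, map_poly of_int p0)"
    by (simp add: P_def poly_pair_map_of_int)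
  obtain pq where pq: "P pq" "\<And>r. P r \<Longrightarrow> degree (fst pq) \<le> degree (fst r)"
    using ex_has_least_nat[of P, OF ex, of "\<lambda>r. degree (fst r)"] by blast
  obtain p q where [simp]: "pq = (p, q)" by (cases pq)
  have p: "poly_pair G p q" "p \<noteq> 0" "poly p a = 0" using pq(1) by (auto simp: P_def)
  have min: "degree p \<le> degree f" if "poly_pair G f g" "f \<noteq> 0" "poly f a = 0" for f g
    using pq(2)[of "(f, g)"] that by (simp add: P_def)
  have "degree p \<noteq> 0" using p(2,3) by (auto elim!: degree_eq_zeroE)
  then have "\<not> constant (poly q)" using poly_pair_degree[OF p(1)] by (simp add: constant_degree)
  then obtain b where b: "poly q b = 0" using fundamental_theorem_of_algebra by blast
  define G' where "G' = {(poly f a, poly g b) | f g. poly_pair G f g}"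
  have G'I: "(x, y) \<in> G'" if "poly_pair G f g" "x = poly f a" "y = poly g b" for x y f g
    using that unfolding G'_def by blast
  have "partial_emb G'"
    unfolding partial_emb_def
  proof (intro conjI allI impI)
    show "(1, 1) \<in> G'"
      by (rule G'I[OF poly_pair_monom[OF partial_embD(1)[OF G], of 0]]) (simp_all add: poly_monom)
  next
    fix x y z w assume "(x, y) \<in> G'" "(z, w) \<in> G'"
    then obtain f g f' g' where fg: "poly_pair G f g" "x = poly f a" "y = poly g b"
      "poly_pair G f' g'" "z = poly f' a" "w = poly g' b" unfolding G'_def by blast
    show "(x + z, y + w) \<in> G'" by (rule G'I[OF poly_pair_add[OF fg(1,4)]]) (simp_all add: fg)
    show "(x * z, y * w) \<in> G'" by (rule G'I[OF poly_pair_mult[OF fg(1,4)]]) (simp_all add: fg)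
  next
    fix x y assume "(x, y) \<in> G'"
    then obtain f g where fg: "poly_pair G f g" "x = poly f a" "y = poly g b" unfolding G'_def by blast
    show "(- x, - y) \<in> G'" by (rule G'I[OF poly_pair_uminus[OF fg(1)]]) (simp_all add: fg)
    show "algebraic x" unfolding fg(2)
      by (rule algebraic_poly[OF a]) (use fg(1) partial_embD(6)[OF G] in \<open>auto simp: poly_pair_def\<close>)
  next
    fix y assume "(0, y) \<in> G'"
    then obtain f g where fg: "poly_pair G f g" "0 = poly f a" "y = poly g b" unfolding G'_def by blast
    show "y = 0" unfolding fg(3) by (rule poly_pair_root[OF p min b fg(1)]) (use fg(2) in simp_all)
  qed
  moreover have "G \<subseteq> G'"
  proof
    fix r assume "r \<in> G"
    moreover obtain x y where "r = (x, y)" by (cases r)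
    ultimately show "r \<in> G'"
      using G'I[OF poly_pair_monom[of x y 0]] by (simp add: poly_monom)
  qed
  moreover have "(a, b) \<in> G'"
    by (rule G'I[OF poly_pair_monom[OF partial_embD(1)[OF G], of 1]]) (simp_all add: poly_monom)
  ultimately show ?thesis by blast
qed

end

text \<open>Nothing is required outside the algebraic numbers, so a total function can stand for a
  homomorphism defined on them.\<close>

definition alg_hom :: "(complex \<Rightarrow> complex) \<Rightarrow> bool" where
  "alg_hom \<sigma> \<longleftrightarrow> \<sigma> 1 = 1 \<and>
     (\<forall>x y. algebraic x \<longrightarrow> algebraic y \<longrightarrow> \<sigma> (x + y) = \<sigma> x + \<sigma> y \<and> \<sigma> (x * y) = \<sigma> x * \<sigma> y)"

text \<open>The axioms of \<open>partial_emb\<close> speak of at most two pairs at a time, and two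
  pairs from a chain lie in a common member.\<close>

lemma partial_emb_Union:
  assumes "C \<noteq> {}" "subset.chain {G. partial_emb G \<and> G0 \<subseteq> G} C"
  shows "partial_emb (\<Union>C) \<and> G0 \<subseteq> \<Union>C"
proof -
  have C: "partial_emb G" "G0 \<subseteq> G" if "G \<in> C" for G
    using assms(2) that unfolding subset.chain_def by blast+
  have two: "\<exists>G\<in>C. r \<in> G \<and> s \<in> G" if rs: "r \<in> \<Union>C" "s \<in> \<Union>C" for r s
  proof -
    obtain G H where GH: "G \<in> C" "H \<in> C" "r \<in> G" "s \<in> H" using rs by blast
    have "G \<subseteq> H \<or> H \<subseteq> G" using assms(2) GH(1,2) unfolding subset_chain_def by blast
    then show ?thesis using GH by blast
  qed
  have "partial_emb (\<Union>C)"
    unfolding partial_emb_def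
  proof (intro conjI allI impI)
    show "(1, 1) \<in> \<Union>C" using assms(1) C(1) partial_embD(1) by blast
  next
    fix a b c d assume "(a, b) \<in> \<Union>C" "(c, d) \<in> \<Union>C"
    then obtain G where "G \<in> C" "(a, b) \<in> G" "(c, d) \<in> G" using two by blast
    then show "(a + c, b + d) \<in> \<Union>C" "(a * c, b * d) \<in> \<Union>C"
      using C(1) partial_embD(2,3) by blast+
  next
    fix a b assume "(a, b) \<in> \<Union>C"
    then show "(- a, - b) \<in> \<Union>C" "algebraic a" using C(1) partial_embD(4,6) by blast+
  next
    fix b assume "(0, b) \<in> \<Union>C"
    then show "b = 0" using C(1) partial_embD(5) by blast
  qed
  then show ?thesis using assms(1) C(2) by blast
qed

text \<open>A maximal extension is defined at every algebraic number, since
  \<open>partial_emb_extend\<close> would otherwise enlarge it.\<close>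

lemma alg_hom_extending:
  assumes "partial_emb G0"
  shows "\<exists>\<sigma>. alg_hom \<sigma> \<and> (\<forall>(a, b)\<in>G0. \<sigma> a = b)"
proof -
  let ?A = "{G. partial_emb G \<and> G0 \<subseteq> G}"
  have "\<exists>M\<in>?A. \<forall>X\<in>?A. M \<subseteq> X \<longrightarrow> X = M"
  proof (rule subset_Zorn_nonempty)
    show "?A \<noteq> {}" using assms by blast
    show "\<Union>C \<in> ?A" if "C \<noteq> {}" "subset.chain ?A C" for C
      using partial_emb_Union[OF that] by simp
  qed
  then obtain M where M: "partial_emb M" "G0 \<subseteq> M" "\<And>X. partial_emb X \<Longrightarrow> M \<subseteq> X \<Longrightarrow> X = M"
    by auto
  have total: "\<exists>b. (a, b) \<in> M" if alg: "algebraic a" for a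
  proof -
    obtain G' b where "partial_emb G'" "M \<subseteq> G'" "(a, b) \<in> G'"
      using partial_emb_extend[OF M(1) alg] by blast
    then show ?thesis using M(3)[of G'] by blast
  qed
  define \<sigma> where "\<sigma> a = (SOME b. (a, b) \<in> M)" for a
  have \<sigma>: "\<sigma> a = b" if "(a, b) \<in> M" for a b
    unfolding \<sigma>_def using that
  proof (rule some_equality)
    show "c = b" if "(a, c) \<in> M" for c
      by (rule partial_emb_functional[OF M(1) that \<open>(a, b) \<in> M\<close>])
  qed
  have "alg_hom \<sigma>"
    unfolding alg_hom_def
  proof (intro conjI allI impI)
    show "\<sigma> 1 = 1" using \<sigma> partial_embD(1)[OF M(1)] .
  next
    fix x y :: complex assume "algebraic x" "algebraic y"
    then obtain b d where bd: "(x, b) \<in> M" "(y, d) \<in> M" using total by blast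
    show "\<sigma> (x + y) = \<sigma> x + \<sigma> y" "\<sigma> (x * y) = \<sigma> x * \<sigma> y"
      unfolding \<sigma>[OF bd(1)] \<sigma>[OF bd(2)] by (rule \<sigma>, rule partial_embD(2,3)[OF M(1) bd])+
  qed
  moreover have "\<forall>(a, b)\<in>G0. \<sigma> a = b" using \<sigma> M(2) by auto
  ultimately show ?thesis by blast
qed

section \<open>Conjugates as images under homomorphisms\<close>

lemma min_poly_dvd:
  assumes "is_min_poly p x" "poly (map_poly of_rat f) x = 0"
  shows "p dvd f"
proof -
  have "map_poly of_rat f = (map_poly of_rat (f div p) * map_poly of_rat p + map_poly of_rat (f mod p) :: complex poly)"
    by (simp flip: of_rat_poly.hom_mult of_rat_poly.hom_add)
  moreover have "poly (map_poly of_rat p) x = 0" using assms(1) by (simp add: is_min_poly_def)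
  ultimately have "poly (map_poly of_rat (f mod p)) x = 0"
    using assms(2) by simp
  moreover have "p \<noteq> 0" using assms(1) unfolding is_min_poly_def by auto
  moreover have "degree p \<le> degree q" if "q \<noteq> 0" "poly (map_poly of_rat q) x = 0" for q
    using assms(1) that unfolding is_min_poly_def by blast
  ultimately have "f mod p = 0" using degree_mod_less'[of p f] by (meson not_le)
  then show ?thesis by (simp add: dvd_eq_mod_eq_0)
qed

text \<open>On the ring generated by \<open>z\<close> over the rationals, sending f(z) to f(w) is
  well defined because \<open>p\<close> divides every f that vanishes at \<open>z\<close>; this
  homomorphism then extends to all algebraic numbers.\<close>

lemma conjugate_ex_alg_hom:
  assumes p: "is_min_poly p z" and w: "poly (map_poly of_rat p) w = 0"
  shows "\<exists>\<sigma>. alg_hom \<sigma> \<and> \<sigma> z = w"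
proof -
  define G where "G = {(poly (map_poly of_rat f) z, poly (map_poly of_rat f) w) | f. True}"
  have GI: "(x, y) \<in> G" if "x = poly (map_poly of_rat f) z" "y = poly (map_poly of_rat f) w" for x y f
    using that unfolding G_def by blast
  have "algebraic z"
    using p unfolding is_min_poly_def algebraic_iff_of_rat_poly by (intro exI[of _ p]) auto
  have "partial_emb G"
    unfolding partial_emb_def
  proof (intro conjI allI impI)
    show "(1, 1) \<in> G" by (rule GI[of _ 1]) simp_all
  next
    fix a b c d assume "(a, b) \<in> G" "(c, d) \<in> G"
    then obtain f g where fg: "a = poly (map_poly of_rat f) z" "b = poly (map_poly of_rat f) w"
       "c = poly (map_poly of_rat g) z" "d = poly (map_poly of_rat g) w" unfolding G_def by blast
    show "(a + c, b + d) \<in> G" by (rule GI[of _ "f + g"]) (simp_all add: fg of_rat_poly.hom_add)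
    show "(a * c, b * d) \<in> G" by (rule GI[of _ "f * g"]) (simp_all add: fg of_rat_poly.hom_mult)
  next
    fix a b assume "(a, b) \<in> G"
    then obtain f where fg: "a = poly (map_poly of_rat f) z" "b = poly (map_poly of_rat f) w"
      unfolding G_def by blast
    show "(- a, - b) \<in> G" by (rule GI[of _ "- f"]) (simp_all add: fg of_rat_poly.hom_uminus)
    show "algebraic a" unfolding fg(1)
      by (rule algebraic_poly[OF \<open>algebraic z\<close>]) (auto simp: coeff_map_poly intro: rat_imp_algebraic)
  next
    fix b assume "(0, b) \<in> G"
    then obtain f where fg: "0 = poly (map_poly of_rat f) z" "b = poly (map_poly of_rat f) w"
      unfolding G_def by blast
    obtain g where "f = p * g" using min_poly_dvd[OF p fg(1)[symmetric]] by (elim dvdE)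
    then show "b = 0" unfolding fg(2) by (simp add: w of_rat_poly.hom_mult)
  qed
  from alg_hom_extending[OF this] obtain \<sigma> where \<sigma>: "alg_hom \<sigma>" "\<forall>(a, b)\<in>G. \<sigma> a = b" by blast
  have "(z, w) \<in> G" by (rule GI[of _ "[:0, 1:]"]) simp_all
  then have "\<sigma> z = w" using \<sigma>(2) by auto
  then show ?thesis using \<sigma>(1) by blast
qed

lemma algebraic_power: "algebraic (x::complex) \<Longrightarrow> algebraic (x ^ n)"
  by (induction n) (auto intro: rat_imp_algebraic)

context
  fixes \<sigma>
  assumes hom: "alg_hom \<sigma>"
begin

lemma alg_hom_1: "\<sigma> 1 = 1"
  and alg_hom_add: "algebraic x \<Longrightarrow> algebraic y \<Longrightarrow> \<sigma> (x + y) = \<sigma> x + \<sigma> y"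
  and alg_hom_mult: "algebraic x \<Longrightarrow> algebraic y \<Longrightarrow> \<sigma> (x * y) = \<sigma> x * \<sigma> y"
  using hom unfolding alg_hom_def by auto

lemma alg_hom_0: "\<sigma> 0 = 0"
  using alg_hom_add[of 0 0] by simp

lemma alg_hom_uminus: "algebraic x \<Longrightarrow> \<sigma> (- x) = - \<sigma> x"
  using alg_hom_add[of x "- x"] alg_hom_0 by (simp add: eq_neg_iff_add_eq_0 add.commute)

lemma alg_hom_diff: "algebraic x \<Longrightarrow> algebraic y \<Longrightarrow> \<sigma> (x - y) = \<sigma> x - \<sigma> y"
  using alg_hom_add[of x "- y"] alg_hom_uminus[of y] by simp

lemma alg_hom_of_nat: "\<sigma> (of_nat n) = of_nat n"
  by (induction n) (simp_all add: alg_hom_0 alg_hom_1 alg_hom_add rat_imp_algebraic)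

lemma alg_hom_of_int: "\<sigma> (of_int n) = of_int n"
proof (cases n rule: int_cases2)
  case (nonneg k)
  then show ?thesis using alg_hom_of_nat[of k] by simp
next
  case (nonpos k)
  then show ?thesis using alg_hom_of_nat[of k] alg_hom_uminus[of "of_nat k"]
    by (simp add: rat_imp_algebraic)
qed

lemma alg_hom_nonzero: "algebraic x \<Longrightarrow> x \<noteq> 0 \<Longrightarrow> \<sigma> x \<noteq> 0"
  using alg_hom_mult[of x "inverse x"] alg_hom_1 algebraic_inverse[of x] by auto

lemma alg_hom_inverse: "algebraic x \<Longrightarrow> \<sigma> (inverse x) = inverse (\<sigma> x)"
proof (cases "x = 0")
  case False
  assume "algebraic x"
  then have "\<sigma> x * \<sigma> (inverse x) = 1"
    using alg_hom_mult[of x "inverse x"] alg_hom_1 False algebraic_inverse[of x] by auto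
  then show ?thesis by (metis inverse_unique)
qed (simp add: alg_hom_0)

lemma alg_hom_of_rat: "\<sigma> (of_rat q) = of_rat q"
proof -
  obtain a b where "q = of_int a * inverse (of_int b)" 
    by (cases q) (auto simp: Fract_of_int_quotient divide_inverse)
  then have "of_rat q = (of_int a * inverse (of_int b) :: complex)"
    by (simp add: of_rat_mult of_rat_inverse)
  then show ?thesis
    by (simp add: alg_hom_mult alg_hom_inverse alg_hom_of_int rat_imp_algebraic)
qed

lemma alg_hom_power: "algebraic x \<Longrightarrow> \<sigma> (x ^ n) = \<sigma> x ^ n"
  by (induction n) (simp_all add: alg_hom_1 alg_hom_mult algebraic_power)

lemma alg_hom_poly:
  assumes "algebraic x"
  shows "poly (map_poly of_rat p) (\<sigma> x) = \<sigma> (poly (map_poly of_rat p) x)"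
proof (induction p)
  case (pCons c p)
  have "algebraic (poly (map_poly of_rat p) x)"
    by (rule algebraic_poly[OF assms]) (simp add: coeff_map_poly rat_imp_algebraic)
  then show ?case using assms pCons
    by (simp add: map_poly_pCons alg_hom_add alg_hom_mult alg_hom_of_rat rat_imp_algebraic algebraic_mult)
qed (simp add: alg_hom_0)

lemma alg_hom_algebraic_int:
  assumes "algebraic_int x"
  shows "algebraic_int (\<sigma> x)"
proof -
  obtain p where p: "poly (map_poly of_int p) x = 0" "lead_coeff p = 1"
    using assms unfolding algebraic_int_altdef_ipoly by blast
  have eq: "map_poly of_int p = (map_poly of_rat (map_poly of_int p) :: complex poly)"
    by (intro poly_eqI) (simp add: coeff_map_poly)
  have "poly (map_poly of_int p) (\<sigma> x) = 0"
    using alg_hom_poly[OF algebraic_int_imp_algebraic[OF assms], of "map_poly of_int p"] p(1)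
    unfolding eq[symmetric] by (simp add: alg_hom_0)
  then show ?thesis using p(2) unfolding algebraic_int_altdef_ipoly by blast
qed

end

lemma alg_hom_id: "alg_hom (\<lambda>x. x)"
  by (simp add: alg_hom_def)

lemma is_min_poly_exists:
  assumes "algebraic x"
  shows "\<exists>p. is_min_poly p x"
proof -
  let ?P = "\<lambda>p. p \<noteq> 0 \<and> poly (map_poly of_rat p) x = 0"
  obtain p0 where "?P p0" using assms unfolding algebraic_iff_of_rat_poly by blast
  then obtain p where p: "?P p" "\<And>q. ?P q \<Longrightarrow> degree p \<le> degree q"
    using ex_has_least_nat[of ?P p0 degree] by blast
  have "poly (map_poly of_rat (Polynomial.smult (inverse (lead_coeff p)) p)) x = 0"
    using p(1) by (simp add: of_rat_hom.map_poly_hom_smult del: of_rat_inverse)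
  moreover have "lead_coeff (Polynomial.smult (inverse (lead_coeff p)) p) = 1"
    using p(1) by simp
  ultimately have "is_min_poly (Polynomial.smult (inverse (lead_coeff p)) p) x"
    unfolding is_min_poly_def using p by (auto simp: degree_smult_eq)
  then show ?thesis by blast
qed

lemma is_min_poly_imp_algebraic: "is_min_poly p x \<Longrightarrow> algebraic x"
  unfolding is_min_poly_def algebraic_iff_of_rat_poly by (intro exI[of _ p]) auto

text \<open>The roots of the minimal polynomial are exactly the images of \<open>x\<close>: every
  image is a root by \<open>alg_hom_poly\<close>, and every root is an image by
  \<open>conjugate_ex_alg_hom\<close>. In this form closure under the field operations is
  immediate.\<close>

lemma totally_real_iff:
  "totally_real x \<longleftrightarrow> algebraic x \<and> (\<forall>\<sigma>. alg_hom \<sigma> \<longrightarrow> \<sigma> x \<in> \<real>)"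
proof (intro iffI conjI allI impI)
  assume "totally_real x"
  then obtain p where p: "is_min_poly p x" "\<And>z::complex. poly (map_poly of_rat p) z = 0 \<Longrightarrow> z \<in> \<real>"
    unfolding totally_real_def by blast
  show "algebraic x" using p(1) by (rule is_min_poly_imp_algebraic)
  fix \<sigma> assume \<sigma>: "alg_hom \<sigma>"
  have "poly (map_poly of_rat p) x = 0" using p(1) by (simp add: is_min_poly_def)
  then show "\<sigma> x \<in> \<real>"
    using alg_hom_poly[OF \<sigma> \<open>algebraic x\<close>, of p] alg_hom_0[OF \<sigma>] by (intro p(2)) simp
next
  assume *: "algebraic x \<and> (\<forall>\<sigma>. alg_hom \<sigma> \<longrightarrow> \<sigma> x \<in> \<real>)"
  then obtain p where p: "is_min_poly p x" using is_min_poly_exists by blast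
  show "totally_real x"
    unfolding totally_real_def using p * conjugate_ex_alg_hom[OF p] by blast
qed

section \<open>Algebraic integers determined by their conjugates\<close>

lemma algebraic_int_prod_list: "(\<And>x. x \<in> set xs \<Longrightarrow> algebraic_int x) \<Longrightarrow> algebraic_int (prod_list xs :: complex)"
  by (induction xs) (auto intro: int_imp_algebraic_int)

lemma norm_prod_list_less_1:
  "(\<And>x. x \<in> set xs \<Longrightarrow> norm (x::complex) < 1) \<Longrightarrow> xs \<noteq> [] \<Longrightarrow> norm (prod_list xs) < 1"
proof (induction xs)
  case (Cons x xs)
  have "norm x < 1" using Cons.prems by simp
  moreover have "norm (prod_list xs) \<le> 1"
    using Cons by (cases "xs = []") (auto intro: less_imp_le)
  ultimately have "norm x * norm (prod_list xs) < 1"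
    using mult_left_le[of "norm (prod_list xs)" "norm x"] by simp
  then show ?case by (simp add: norm_mult)
qed simp

text \<open>The constant coefficient of the minimal polynomial is an integer of absolute value below 1.\<close>

lemma algebraic_int_eq_0_if_conjugates_small:
  assumes "algebraic_int x" "\<And>\<sigma>. alg_hom \<sigma> \<Longrightarrow> norm (\<sigma> x) < 1"
  shows "x = 0"
proof -
  have alg: "algebraic x" using assms(1) by blast
  then obtain p where p: "is_min_poly p x" using is_min_poly_exists by blast
  let ?p = "map_poly of_rat p :: complex poly"
  have p1: "lead_coeff p = 1" "poly ?p x = 0" using p by (auto simp: is_min_poly_def)
  have conj: "\<exists>\<sigma>. alg_hom \<sigma> \<and> \<sigma> x = w" if "poly ?p w = 0" for w
    using conjugate_ex_alg_hom[OF p that] .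
  have "p \<noteq> 0" using p1(1) by force
  have deg: "degree ?p = degree p" by (rule degree_map_poly) simp
  have lc: "lead_coeff ?p = 1" using p1(1) by (simp add: deg coeff_map_poly)
  obtain as where as: "(\<Prod>a\<leftarrow>as. [:- a, 1:]) = ?p" "length as = degree ?p"
    using fundamental_theorem_algebra_factorized[of ?p] lc by auto
  have root: "poly ?p a = 0" if "a \<in> set as" for a
    unfolding as(1)[symmetric] poly_prod_list using that by (auto simp: prod_list_zero_iff)
  have "degree p \<noteq> 0"
  proof
    assume "degree p = 0"
    then obtain c where "p = [:c:]" by (rule degree_eq_zeroE)
    then show False using p1 by simp
  qed
  then have "as \<noteq> []" using as(2) deg by auto
  have p0: "poly ?p 0 = (\<Prod>a\<leftarrow>as. - a)"
    unfolding as(1)[symmetric] poly_prod_list by (simp add: comp_def)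
  have "norm (poly ?p 0) < 1"
    unfolding p0
  proof (rule norm_prod_list_less_1)
    fix b assume "b \<in> set (map uminus as)"
    then obtain a where a: "a \<in> set as" "b = - a" by auto
    obtain \<sigma> where "alg_hom \<sigma>" "\<sigma> x = a" using conj[OF root[OF a(1)]] by blast
    then show "norm b < 1" using assms(2)[of \<sigma>] a(2) by simp
  qed (use \<open>as \<noteq> []\<close> in simp)
  moreover have "algebraic_int (poly ?p 0)"
    unfolding p0
  proof (rule algebraic_int_prod_list)
    fix b assume "b \<in> set (map uminus as)"
    then obtain a where a: "a \<in> set as" "b = - a" by auto
    obtain \<sigma> where "alg_hom \<sigma>" "\<sigma> x = a" using conj[OF root[OF a(1)]] by blast
    then show "algebraic_int b" using alg_hom_algebraic_int[of \<sigma> x] assms(1) a(2) by simp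
  qed
  moreover have "poly ?p 0 = of_rat (coeff p 0)" by (simp add: poly_0_coeff_0 coeff_map_poly)
  moreover have "of_rat (coeff p 0) \<in> (\<rat> :: complex set)" by (rule Rats_of_rat)
  ultimately have "poly ?p 0 \<in> \<int>" "norm (poly ?p 0) < 1"
    using rational_algebraic_int_is_int by metis+
  moreover from this(1) obtain k where "poly ?p 0 = of_int k" by (rule Ints_cases)
  ultimately have "poly ?p 0 = 0" by simp
  \<comment> \<open>A vanishing constant coefficient makes 0 a conjugate of \<open>x\<close>, and
    homomorphisms are injective on algebraic numbers.\<close>
  then obtain \<sigma> where "alg_hom \<sigma>" "\<sigma> x = 0" using conj by blast
  then show ?thesis using alg_hom_nonzero alg by blast
qed

text \<open>All roots of the minimal polynomial equal \<open>x\<close>. A repeated root would be a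
  root of the derivative, which has smaller degree; so the polynomial is linear and \<open>x\<close>
  is rational.\<close>

lemma algebraic_int_in_Ints_if_conjugates_eq:
  assumes "algebraic_int x" "\<And>\<sigma>. alg_hom \<sigma> \<Longrightarrow> \<sigma> x = x"
  shows "x \<in> \<int>"
proof -
  have alg: "algebraic x" using assms(1) by blast
  then obtain p where p: "is_min_poly p x" using is_min_poly_exists by blast
  let ?p = "map_poly of_rat p :: complex poly"
  have p1: "lead_coeff p = 1" "poly ?p x = 0" using p by (auto simp: is_min_poly_def)
  have min: "degree p \<le> degree q" if "q \<noteq> 0" "poly (map_poly of_rat q) x = 0" for q
    using p that by (auto simp: is_min_poly_def)
  have conj: "w = x" if "poly ?p w = 0" for w
    using conjugate_ex_alg_hom[OF p that] assms(2) by blast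
  obtain q where q: "?p = [:- x, 1:] * q" using p1(2) by (metis dvdE poly_eq_0_iff_dvd)
  have deg: "degree ?p = degree p" by (rule degree_map_poly) simp
  have "?p \<noteq> 0" using p1(1) deg by auto
  then have "q \<noteq> 0" using q by auto
  then have degq: "degree ?p = Suc (degree q)" unfolding q by (subst degree_mult_eq) auto
  have "degree q = 0"
  proof (rule ccontr)
    assume "degree q \<noteq> 0"
    then have "\<not> constant (poly q)" by (simp add: constant_degree)
    then obtain w where w: "poly q w = 0" using fundamental_theorem_of_algebra by blast
    then have "poly ?p w = 0" by (simp add: q)
    then have "poly q x = 0" using conj w by blast
    then have "poly (pderiv ?p) x = 0" unfolding q pderiv_mult by (simp add: pderiv_pCons)
    then have "poly (map_poly of_rat (pderiv p)) x = 0"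
      by (simp add: of_rat_hom.map_poly_pderiv)
    moreover have "pderiv p \<noteq> 0" using degq deg by (simp add: pderiv_eq_0_iff)
    ultimately have "degree p \<le> degree (pderiv p)" using min by blast
    then show False using degq deg by (simp add: degree_pderiv)
  qed
  then have "degree p = 1" using degq deg by simp
  then have "of_rat (coeff p 0) + x = 0"
    using p1 unfolding poly_altdef deg by (simp add: coeff_map_poly)
  then have "x = of_rat (- coeff p 0)" by (simp add: of_rat_minus eq_neg_iff_add_eq_0 add.commute)
  then have "x \<in> \<rat>" by (metis Rats_of_rat)
  then show ?thesis using assms(1) rational_algebraic_int_is_int by blast
qed

section \<open>Totally real numbers and units\<close>

lemma Q_tr_iff: "x \<in> Q_tr \<longleftrightarrow> algebraic x \<and> (\<forall>\<sigma>. alg_hom \<sigma> \<longrightarrow> \<sigma> x \<in> \<real>)"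
  by (simp add: Q_tr_def totally_real_iff)

lemma Q_tr_algebraic: "x \<in> Q_tr \<Longrightarrow> algebraic x"
  and Q_tr_alg_hom_real: "x \<in> Q_tr \<Longrightarrow> alg_hom \<sigma> \<Longrightarrow> \<sigma> x \<in> \<real>"
  by (simp_all add: Q_tr_iff)

lemma Q_tr_real: "x \<in> Q_tr \<Longrightarrow> x \<in> \<real>"
  using Q_tr_alg_hom_real[OF _ alg_hom_id] by simp

lemma Q_tr_add: "x \<in> Q_tr \<Longrightarrow> y \<in> Q_tr \<Longrightarrow> x + y \<in> Q_tr"
  and Q_tr_mult: "x \<in> Q_tr \<Longrightarrow> y \<in> Q_tr \<Longrightarrow> x * y \<in> Q_tr"
  and Q_tr_uminus: "x \<in> Q_tr \<Longrightarrow> - x \<in> Q_tr"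
  and Q_tr_inverse: "x \<in> Q_tr \<Longrightarrow> inverse x \<in> Q_tr"
  by (simp_all add: Q_tr_iff alg_hom_add alg_hom_mult alg_hom_uminus alg_hom_inverse
      algebraic_add algebraic_mult algebraic_minus algebraic_inverse)

lemma Q_tr_diff: "x \<in> Q_tr \<Longrightarrow> y \<in> Q_tr \<Longrightarrow> x - y \<in> Q_tr"
  using Q_tr_add[of x "- y"] Q_tr_uminus[of y] by simp

lemma Q_tr_of_int: "of_int n \<in> Q_tr"
  by (simp add: Q_tr_iff alg_hom_of_int rat_imp_algebraic)

lemma Q_tr_0: "0 \<in> Q_tr" and Q_tr_1: "1 \<in> Q_tr" and Q_tr_of_nat: "of_nat k \<in> Q_tr"
  and Q_tr_numeral: "numeral m \<in> Q_tr"
  using Q_tr_of_int[of 0] Q_tr_of_int[of 1] Q_tr_of_int[of "int k"] Q_tr_of_int[of "numeral m"]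
  by simp_all

text \<open>Coordinates for a field given as a hull. Closure under inverses rests on
  \<open>a\<close> and \<open>b\<close> being real: then \<open>a * a + b * b\<close> vanishes only
  when both do.\<close>

lemma Q_tr_i_iff: "z \<in> Q_tr_i \<longleftrightarrow> (\<exists>a\<in>Q_tr. \<exists>b\<in>Q_tr. z = a + b * \<i>)"
proof
  let ?K = "{z. \<exists>a\<in>Q_tr. \<exists>b\<in>Q_tr. z = a + b * \<i>}"
  have KI: "a + b * \<i> \<in> ?K" if "a \<in> Q_tr" "b \<in> Q_tr" for a b using that by blast
  have "is_subfield ?K"
    unfolding is_subfield_def
  proof (intro conjI ballI)
    show "0 \<in> ?K" "1 \<in> ?K" using KI[OF Q_tr_0 Q_tr_0] KI[OF Q_tr_1 Q_tr_0] by simp_all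
  next
    fix x y assume "x \<in> ?K" "y \<in> ?K"
    then obtain a b c d where x: "x = a + b * \<i>" and y: "y = c + d * \<i>"
      and Q: "a \<in> Q_tr" "b \<in> Q_tr" "c \<in> Q_tr" "d \<in> Q_tr" by auto
    have "(a + c) + (b + d) * \<i> \<in> ?K" by (intro KI Q_tr_add Q)
    then show "x + y \<in> ?K" unfolding x y by (simp add: algebra_simps)
    have "(a * c - b * d) + (a * d + b * c) * \<i> \<in> ?K" by (intro KI Q_tr_add Q_tr_diff Q_tr_mult Q)
    moreover have "x * y = (a * c - b * d) + (a * d + b * c) * \<i>"
      unfolding x y by (simp add: algebra_simps)
    ultimately show "x * y \<in> ?K" by metis
  next
    fix x assume "x \<in> ?K"
    then obtain a b where x: "x = a + b * \<i>" and Q: "a \<in> Q_tr" "b \<in> Q_tr" by auto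
    have "(- a) + (- b) * \<i> \<in> ?K" by (intro KI Q_tr_uminus Q)
    then show "- x \<in> ?K" unfolding x by simp
    define n where "n = inverse (a * a + b * b)"
    have "a * n + (- b * n) * \<i> \<in> ?K"
      unfolding n_def by (intro KI Q_tr_add Q_tr_mult Q_tr_uminus Q_tr_inverse Q)
    moreover have "inverse x = a * n + (- b * n) * \<i>"
    proof -
      obtain r s where rs: "a = of_real r" "b = of_real s"
        using Q_tr_real Q by (metis Reals_cases)
      show ?thesis
      proof (cases "a * a + b * b = 0")
        case True
        then have "r * r + s * s = 0" unfolding rs by (metis of_real_add of_real_mult of_real_eq_0_iff)
        then have "r = 0 \<and> s = 0" by (metis sum_squares_eq_zero_iff)
        then show ?thesis by (simp add: x rs)
      next
        case False
        have "x * (a * n + (- b * n) * \<i>) = (a * a + b * b) * n" unfolding x by (simp add: algebra_simps)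
        also have "\<dots> = 1" unfolding n_def using False by (rule right_inverse)
        finally show ?thesis by (rule inverse_unique)
      qed
    qed
    ultimately show "inverse x \<in> ?K" by metis
  qed
  moreover have "insert \<i> Q_tr \<subseteq> ?K"
    using KI[OF Q_tr_0 Q_tr_1] KI[OF _ Q_tr_0] by auto
  ultimately have "Q_tr_i \<subseteq> ?K" unfolding Q_tr_i_def by (rule hull_minimal[rotated])
  then show "\<exists>a\<in>Q_tr. \<exists>b\<in>Q_tr. z = a + b * \<i>" if "z \<in> Q_tr_i" using that by blast
next
  assume "\<exists>a\<in>Q_tr. \<exists>b\<in>Q_tr. z = a + b * \<i>"
  moreover have "insert \<i> Q_tr \<subseteq> Q_tr_i" unfolding Q_tr_i_def by (rule hull_subset)
  ultimately show "z \<in> Q_tr_i" using is_subfield_Q_tr_i unfolding is_subfield_def by blast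
qed

lemma Q_tr_subset_Q_tr_i: "x \<in> Q_tr \<Longrightarrow> x \<in> Q_tr_i"
  unfolding Q_tr_i_iff using Q_tr_0 by (metis add.right_neutral mult_zero_left)

lemma Q_tr_i_real: "z \<in> Q_tr_i \<Longrightarrow> z \<in> \<real> \<Longrightarrow> z \<in> Q_tr"
proof -
  assume "z \<in> Q_tr_i" "z \<in> \<real>"
  then obtain a b where ab: "a \<in> Q_tr" "b \<in> Q_tr" "z = a + b * \<i>" unfolding Q_tr_i_iff by blast
  have "Im a = 0" "Im b = 0" using ab Q_tr_real by (auto simp: complex_is_Real_iff)
  then have "b = 0" using \<open>z \<in> \<real>\<close> ab(3) by (simp add: complex_is_Real_iff complex_eq_iff)
  then show "z \<in> Q_tr" using ab by simp
qed

lemma Q_tr_i_cnj: "z \<in> Q_tr_i \<Longrightarrow> cnj z \<in> Q_tr_i"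
proof -
  assume "z \<in> Q_tr_i"
  then obtain a b where ab: "a \<in> Q_tr" "b \<in> Q_tr" "z = a + b * \<i>" by (auto simp: Q_tr_i_iff)
  then have "cnj z = a + (- b) * \<i>" using Q_tr_real by (auto simp: Reals_cnj_iff)
  then show ?thesis unfolding Q_tr_i_iff using ab Q_tr_uminus by blast
qed

text \<open>A homomorphism maps \<open>Q_tr\<close> into the reals and \<i> to \<i> or its negative;
  conjugation fixes the former and negates the latter. This is the property of CM fields behind the
  unit argument.\<close>

lemma alg_hom_cnj:
  assumes \<sigma>: "alg_hom \<sigma>" and "z \<in> Q_tr_i"
  shows "\<sigma> (cnj z) = cnj (\<sigma> z)"
proof -
  obtain a b where ab: "a \<in> Q_tr" "b \<in> Q_tr" "z = a + b * \<i>"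
    using assms(2) by (auto simp: Q_tr_i_iff)
  have cz: "cnj z = a - b * \<i>" using Q_tr_real ab by (auto simp: Reals_cnj_iff)
  have "\<sigma> \<i> * \<sigma> \<i> = - 1"
    using alg_hom_mult[OF \<sigma>, of \<i> \<i>] alg_hom_of_int[OF \<sigma>, of "-1"] by simp
  then have "(\<sigma> \<i> - \<i>) * (\<sigma> \<i> + \<i>) = 0" by (simp add: algebra_simps)
  then have "\<sigma> \<i> = \<i> \<or> \<sigma> \<i> = - \<i>" by (auto simp: eq_neg_iff_add_eq_0)
  then have i: "cnj (\<sigma> \<i>) = - \<sigma> \<i>" by auto
  have real: "cnj (\<sigma> a) = \<sigma> a" "cnj (\<sigma> b) = \<sigma> b"
    using ab Q_tr_alg_hom_real[OF _ \<sigma>] by (auto simp: Reals_cnj_iff)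
  have alg: "algebraic a" "algebraic b" "algebraic (b * \<i>)"
    using ab Q_tr_algebraic by (auto intro!: algebraic_mult)
  show ?thesis unfolding cz unfolding ab(3)
    by (simp add: alg_hom_add[OF \<sigma>] alg_hom_diff[OF \<sigma>] alg_hom_mult[OF \<sigma>] alg real i)
qed

abbreviation Z_tr_i :: "complex set" where
  "Z_tr_i \<equiv> ring_of_integers Q_tr_i"

lemma Z_tr_i_iff: "z \<in> Z_tr_i \<longleftrightarrow> z \<in> Q_tr_i \<and> algebraic_int z"
  by (simp add: ring_of_integers_def)

lemma Z_tr_iff: "z \<in> Z_tr \<longleftrightarrow> z \<in> Q_tr \<and> algebraic_int z"
  by (simp add: ring_of_integers_def)

text \<open>In \<open>a + b * \<i>\<close> with real \<open>a\<close> and \<open>b\<close>, reality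
  forces \<open>b = 0\<close>. Defining \<open>Z_tr\<close> inside \<open>Z_tr_i\<close> thus
  amounts to singling out the real elements.\<close>

lemma Z_tr_iff_real: "z \<in> Z_tr \<longleftrightarrow> z \<in> Z_tr_i \<and> z \<in> \<real>"
  unfolding Z_tr_i_iff Z_tr_iff using Q_tr_real Q_tr_i_real Q_tr_subset_Q_tr_i by blast

lemma Z_tr_i_add: "x \<in> Z_tr_i \<Longrightarrow> y \<in> Z_tr_i \<Longrightarrow> x + y \<in> Z_tr_i"
  and Z_tr_i_mult: "x \<in> Z_tr_i \<Longrightarrow> y \<in> Z_tr_i \<Longrightarrow> x * y \<in> Z_tr_i"
  and Z_tr_i_uminus: "x \<in> Z_tr_i \<Longrightarrow> - x \<in> Z_tr_i"
  using is_subfield_Q_tr_i unfolding Z_tr_i_iff is_subfield_def by auto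

lemma Z_tr_i_diff: "x \<in> Z_tr_i \<Longrightarrow> y \<in> Z_tr_i \<Longrightarrow> x - y \<in> Z_tr_i"
  using Z_tr_i_add[of x "- y"] Z_tr_i_uminus[of y] by simp

lemma Z_tr_of_nat: "of_nat k \<in> Z_tr"
  by (simp add: Z_tr_iff Q_tr_of_nat int_imp_algebraic_int)

lemma Z_tr_i_of_nat: "of_nat k \<in> Z_tr_i"
  using Z_tr_of_nat Z_tr_iff_real by blast

lemma Z_tr_i_0: "0 \<in> Z_tr_i" and Z_tr_i_1: "1 \<in> Z_tr_i" and Z_tr_i_numeral: "numeral m \<in> Z_tr_i"
  using Z_tr_i_of_nat[of 0] Z_tr_i_of_nat[of 1] Z_tr_i_of_nat[of "numeral m"] by simp_all

lemma Z_tr_i_power: "x \<in> Z_tr_i \<Longrightarrow> x ^ n \<in> Z_tr_i"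
  by (induction n) (simp_all add: Z_tr_i_1 Z_tr_i_mult)

text \<open>Every image of a square root of \<open>x\<close> squares to a nonnegative real and is
  therefore real.\<close>

lemma Z_tr_sqrt:
  assumes x: "x \<in> Z_tr" and nonneg: "\<And>\<sigma>. alg_hom \<sigma> \<Longrightarrow> 0 \<le> Re (\<sigma> x)"
  shows "\<exists>r\<in>Z_tr. r ^ 2 = x"
proof
  have int: "algebraic_int (csqrt x)" using x by (auto simp: Z_tr_iff)
  have "\<sigma> (csqrt x) \<in> \<real>" if \<sigma>: "alg_hom \<sigma>" for \<sigma>
  proof -
    have "(\<sigma> (csqrt x))\<^sup>2 = \<sigma> x"
      using alg_hom_power[OF \<sigma>, of "csqrt x" 2] int by auto
    moreover have "\<sigma> x = of_real (Re (\<sigma> x))"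
      using Q_tr_alg_hom_real[OF _ \<sigma>, of x] x by (simp add: Z_tr_iff of_real_Re)
    ultimately have "(\<sigma> (csqrt x))\<^sup>2 = (of_real (sqrt (Re (\<sigma> x))))\<^sup>2"
      using nonneg[OF \<sigma>] by (simp flip: of_real_power)
    then show ?thesis unfolding power2_eq_iff by auto
  qed
  then show "csqrt x \<in> Z_tr" using int by (auto simp: Z_tr_iff Q_tr_iff)
  show "(csqrt x)\<^sup>2 = x" by simp
qed

text \<open>The unit \<open>t = 1 + 3g\<close> has \<open>t / cnj t\<close> of absolute value 1 at every embedding, and
  \<open>t / cnj t - 1 = 3 \<beta>\<close> with \<open>\<beta>\<close> an algebraic integer whose conjugates are at most \<open>2/3\<close>.\<close>

lemma unit_congruent_1_mod_3_real:
  assumes g: "g \<in> Z_tr_i" and u: "u \<in> Z_tr_i" and unit: "(1 + 3 * g) * u = 1"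
  shows "g \<in> \<real>"
proof -
  \<comment> \<open>Since \<open>cnj u\<close> is the inverse of the conjugate of the unit t = 1 + 3
    g, t / cnj t - 1 = (t - cnj t) * cnj u, and t - cnj t = 3 (g - cnj g).\<close>
  define \<beta> where "\<beta> = (g - cnj g) * cnj u"
  have gu: "g \<in> Q_tr_i" "u \<in> Q_tr_i" "cnj g \<in> Q_tr_i" "cnj u \<in> Q_tr_i"
    "algebraic_int g" "algebraic_int u"
    using g u Q_tr_i_cnj by (auto simp: Z_tr_i_iff)
  have alg: "algebraic g" "algebraic u" "algebraic (cnj g)" "algebraic (cnj u)" "algebraic 3"
    using gu by (auto intro: rat_imp_algebraic)
  have "algebraic_int \<beta>" unfolding \<beta>_def using gu by auto
  moreover have "norm (\<sigma> \<beta>) < 1" if \<sigma>: "alg_hom \<sigma>" for \<sigma>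
  proof -
    have s1: "\<sigma> 1 = 1" using alg_hom_1[OF \<sigma>] .
    have s3: "\<sigma> 3 = 3" using alg_hom_of_nat[OF \<sigma>, of 3] by simp
    have "\<sigma> ((1 + 3 * g) * u) = 1" unfolding unit by (rule s1)
    then have 1: "(1 + 3 * \<sigma> g) * \<sigma> u = 1"
      using alg by (simp add: alg_hom_add[OF \<sigma>] alg_hom_mult[OF \<sigma>] s1 s3 algebraic_mult algebraic_add rat_imp_algebraic)
    have b: "\<sigma> \<beta> = (\<sigma> g - cnj (\<sigma> g)) * cnj (\<sigma> u)"
    proof -
      have "algebraic (g - cnj g)"
        by (intro algebraic_int_imp_algebraic algebraic_int_diff algebraic_int_cnj gu(5))
      then show ?thesis
        unfolding \<beta>_def using alg gu
        by (simp add: alg_hom_mult[OF \<sigma>] alg_hom_diff[OF \<sigma>] alg_hom_cnj[OF \<sigma>])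
    qed
    have "3 * \<sigma> \<beta> = (1 + 3 * \<sigma> g) * cnj (\<sigma> u) - cnj ((1 + 3 * \<sigma> g) * \<sigma> u)"
      unfolding b by (simp add: algebra_simps)
    then have "3 * \<sigma> \<beta> = (1 + 3 * \<sigma> g) * cnj (\<sigma> u) - 1" unfolding 1 by simp
    moreover have "norm ((1 + 3 * \<sigma> g) * cnj (\<sigma> u)) = norm ((1 + 3 * \<sigma> g) * \<sigma> u)"
      by (simp add: norm_mult)
    ultimately have "norm (3 * \<sigma> \<beta>) \<le> 1 + 1"
      unfolding 1 by (metis norm_triangle_ineq4 norm_one)
    then show ?thesis by (simp add: norm_mult)
  qed
  ultimately have "\<beta> = 0" by (rule algebraic_int_eq_0_if_conjugates_small)
  moreover have "u \<noteq> 0" using unit by auto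
  ultimately have "g = cnj g" unfolding \<beta>_def by simp
  then show ?thesis by (simp add: Reals_cnj_iff)
qed

text \<open>With \<open>g\<close> real and \<open>1 + 3 * g\<close> invertible, the equation can be
  solved for the square of \<open>x\<close>; the sign of \<open>x\<close> is lost.\<close>

lemma real_square_of_unit_condition:
  assumes "g \<in> Z_tr_i" "u \<in> Z_tr_i" "(1 + 3 * g) * u = 1" "g\<^sup>2 = 4 * x\<^sup>2 * (1 + 3 * g)"
  shows "x\<^sup>2 \<in> \<real>"
proof -
  have "g \<in> \<real>" using unit_congruent_1_mod_3_real[OF assms(1-3)] .
  have "1 + 3 * g \<noteq> 0" using assms(3) by auto
  then have "4 * (1 + 3 * g) \<noteq> 0" unfolding mult_eq_0_iff by simp
  moreover have "x\<^sup>2 * (4 * (1 + 3 * g)) = g\<^sup>2" unfolding assms(4) by (simp only: mult_ac)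
  ultimately have "x\<^sup>2 = g\<^sup>2 / (4 * (1 + 3 * g))" by (rule nonzero_eq_divide_eq[THEN iffD2])
  with \<open>g \<in> \<real>\<close> show ?thesis by (simp add: Reals_divide Reals_power Reals_mult Reals_add)
qed

text \<open>The factor 4 makes \<open>g = 2 x s\<close> with \<open>s = 3 x + sqrt (9 x\<^sup>2 + 1)\<close> integral; then \<open>1 + 3 g = s\<^sup>2\<close>.\<close>

lemma unit_condition_exists:
  assumes x: "x \<in> Z_tr"
  shows "\<exists>g\<in>Z_tr_i. \<exists>u\<in>Z_tr_i. g\<^sup>2 = 4 * x\<^sup>2 * (1 + 3 * g) \<and> (1 + 3 * g) * u = 1"
proof -
  have xi: "x \<in> Z_tr_i" "x \<in> Q_tr" using x Z_tr_iff_real by (auto simp: Z_tr_iff)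
  have alg: "algebraic x" using xi(2) Q_tr_algebraic by blast
  have "9 * x\<^sup>2 + 1 \<in> Z_tr"
    unfolding Z_tr_iff_real using xi(1) Q_tr_real[OF xi(2)]
    by (auto intro!: Z_tr_i_add Z_tr_i_mult Z_tr_i_power Z_tr_i_numeral Z_tr_i_1)
  moreover have "0 \<le> Re (\<sigma> (9 * x\<^sup>2 + 1))" if \<sigma>: "alg_hom \<sigma>" for \<sigma>
  proof -
    have "\<sigma> (9 * x\<^sup>2 + 1) = 9 * (\<sigma> x)\<^sup>2 + 1"
      using alg alg_hom_of_nat[OF \<sigma>, of 9] rat_imp_algebraic[of "9::complex"]
      by (simp add: alg_hom_add[OF \<sigma>] alg_hom_mult[OF \<sigma>] alg_hom_power[OF \<sigma>] alg_hom_1[OF \<sigma>]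
          algebraic_mult algebraic_power rat_imp_algebraic)
    moreover obtain r where "\<sigma> x = of_real r" using Q_tr_alg_hom_real[OF xi(2) \<sigma>] by (rule Reals_cases)
    ultimately have "\<sigma> (9 * x\<^sup>2 + 1) = of_real (9 * r\<^sup>2 + 1)" by simp
    then show ?thesis by simp
  qed
  ultimately obtain r where r: "r \<in> Z_tr" "r\<^sup>2 = 9 * x\<^sup>2 + 1" using Z_tr_sqrt by blast
  define s where "s = 3 * x + r"
  have s: "s \<in> Z_tr_i"
    unfolding s_def using xi(1) r(1) Z_tr_iff_real Z_tr_i_numeral by (intro Z_tr_i_add Z_tr_i_mult) auto
  have s2: "s\<^sup>2 = 1 + 6 * x * s"
    unfolding s_def power2_sum r(2) by (simp add: algebra_simps power2_eq_square)
  have "2 * x * s \<in> Z_tr_i" "(s - 6 * x)\<^sup>2 \<in> Z_tr_i"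
    by (intro Z_tr_i_mult Z_tr_i_power Z_tr_i_diff Z_tr_i_numeral s xi(1))+
  moreover have "(2 * x * s)\<^sup>2 = 4 * x\<^sup>2 * (1 + 3 * (2 * x * s))"
    by (simp add: power_mult_distrib s2)
  \<comment> \<open>Here \<open>s - 6 * x\<close> is \<open>r - 3 * x\<close>, and
    \<open>(r + 3 * x) * (r - 3 * x) = 1\<close> by the choice of \<open>r\<close>.\<close>
  moreover have "s * (s - 6 * x) = 1" using s2 by (simp add: algebra_simps power2_eq_square)
  then have "s\<^sup>2 * (s - 6 * x)\<^sup>2 = 1" by (simp flip: power_mult_distrib)
  then have "(1 + 3 * (2 * x * s)) * (s - 6 * x)\<^sup>2 = 1" by (simp add: s2 mult.assoc)
  ultimately show ?thesis by blast
qed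

text \<open>Reality of the square alone would admit purely imaginary \<open>x\<close>; the squares
  of \<open>x\<close> and \<open>x + 1\<close> together recover \<open>2 * x\<close>
  linearly.\<close>

lemma Z_tr_existential_characterization:
  assumes "x \<in> Z_tr_i"
  shows "x \<in> Z_tr \<longleftrightarrow> (\<exists>g\<in>Z_tr_i. \<exists>u\<in>Z_tr_i. \<exists>h\<in>Z_tr_i. \<exists>v\<in>Z_tr_i.
    g\<^sup>2 = 4 * x\<^sup>2 * (1 + 3 * g) \<and> (1 + 3 * g) * u = 1 \<and>
    h\<^sup>2 = 4 * (x + 1)\<^sup>2 * (1 + 3 * h) \<and> (1 + 3 * h) * v = 1)" (is "_ \<longleftrightarrow> ?R")
proof
  assume x: "x \<in> Z_tr"
  then have "x + 1 \<in> Z_tr" using Z_tr_iff_real Z_tr_i_add Z_tr_i_1 by auto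
  then show ?R using unit_condition_exists[OF x] unit_condition_exists[of "x + 1"] by blast
next
  assume ?R
  then have "x\<^sup>2 \<in> \<real>" "(x + 1)\<^sup>2 \<in> \<real>" using real_square_of_unit_condition by blast+
  then have "(x + 1)\<^sup>2 - x\<^sup>2 - 1 \<in> \<real>" by simp
  moreover have "(x + 1)\<^sup>2 - x\<^sup>2 - 1 = 2 * x" by (simp add: power2_eq_square algebra_simps)
  ultimately have "2 * x / 2 \<in> \<real>" by (metis Reals_divide Reals_numeral)
  then show "x \<in> Z_tr" using assms by (simp add: Z_tr_iff_real)
qed

section \<open>Roots of unity\<close>

definition root_of_unity :: "complex \<Rightarrow> bool" where
  "root_of_unity w \<longleftrightarrow> (\<exists>n>0. w ^ n = 1)"

lemma algebraic_int_power: "algebraic_int (x::complex) \<Longrightarrow> algebraic_int (x ^ n)"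
  by (induction n) (auto intro: int_imp_algebraic_int)

lemma algebraic_int_of_nat: "algebraic_int (of_nat n :: complex)"
  and algebraic_int_of_int: "algebraic_int (of_int k :: complex)"
  and algebraic_int_1: "algebraic_int (1 :: complex)"
  by (simp_all add: int_imp_algebraic_int)

lemma algebraic_int_sum: "(\<And>i. i \<in> I \<Longrightarrow> algebraic_int (f i)) \<Longrightarrow> algebraic_int (\<Sum>i\<in>I. f i :: complex)"
  by (induction I rule: infinite_finite_induct) auto

lemma root_of_unity_algebraic_int: "root_of_unity w \<Longrightarrow> algebraic_int w"
proof -
  assume "root_of_unity w"
  then obtain n where n: "n > 0" "w ^ n = 1" by (auto simp: root_of_unity_def)
  show ?thesis
  proof (rule algebraic_int_root[of 1 "Polynomial.monom 1 n"])
    show "poly (Polynomial.monom 1 n) w = 1" using n by (simp add: poly_monom)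
  qed (use n in \<open>simp_all add: degree_monom_eq algebraic_int_1\<close>)
qed

lemma root_of_unity_alg_hom:
  assumes "alg_hom \<sigma>" "algebraic w" "w ^ n = 1"
  shows "\<sigma> w ^ n = 1"
  using alg_hom_power[OF assms(1,2), of n] assms(3) alg_hom_1[OF assms(1)] by simp

lemma root_of_unity_norm: "root_of_unity w \<Longrightarrow> norm w = 1"
proof -
  assume "root_of_unity w"
  then obtain n where n: "n > 0" "w ^ n = 1" by (auto simp: root_of_unity_def)
  then have "norm w ^ n = 1" by (simp flip: norm_power)
  then show ?thesis using n(1) power_eq_imp_eq_base[of "norm w" n 1] by simp
qed

lemma root_of_unity_mult_cnj: "root_of_unity w \<Longrightarrow> w * cnj w = 1"
  using complex_norm_square[of w] by (simp add: root_of_unity_norm)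

text \<open>Kronecker's theorem by the pigeonhole principle: two powers of \<open>w\<close> are close at all
  conjugates simultaneously, hence equal.\<close>

lemma root_of_unity_if_conjugates_norm_1:
  assumes w: "algebraic_int w" and norm: "\<And>\<sigma>. alg_hom \<sigma> \<Longrightarrow> norm (\<sigma> w) = 1"
  shows "root_of_unity w"
proof -
  have alg: "algebraic w" using w by blast
  then obtain p where p: "is_min_poly p w" using is_min_poly_exists by blast
  define Z where "Z = {z. poly (map_poly of_rat p) z = (0::complex)}"
  have "lead_coeff p = 1" using p by (simp add: is_min_poly_def)
  then have "map_poly of_rat p \<noteq> (0 :: complex poly)" by auto
  then have fin: "finite Z" unfolding Z_def by (rule poly_roots_finite)
  have conj: "\<sigma> w \<in> Z" if "alg_hom \<sigma>" for \<sigma>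
    using alg_hom_poly[OF that alg, of p] alg_hom_0[OF that] p by (simp add: Z_def is_min_poly_def)
  have normZ: "norm z = 1" if "z \<in> Z" for z
    using conjugate_ex_alg_hom[OF p, of z] that norm by (auto simp: Z_def)
  \<comment> \<open>\<open>F k\<close> records the cell of side 1/2 containing the
    \<open>k\<close>-th power of each conjugate. The unit circle meets finitely many cells, and
    within one cell the real and imaginary differences add up to less than 1.\<close>
  define F where "F k = (\<lambda>z\<in>Z. (\<lfloor>2 * Re (z ^ k)\<rfloor>, \<lfloor>2 * Im (z ^ k)\<rfloor>))" for k :: nat
  have floor: "\<lfloor>2 * r\<rfloor> \<in> {-2..2}" if "\<bar>r\<bar> \<le> 1" for r :: real
    using that by (auto simp: le_floor_iff floor_le_iff)
  have "range F \<subseteq> Z \<rightarrow>\<^sub>E {-2..2} \<times> {-2..2}"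
  proof
    fix f assume "f \<in> range F"
    then obtain k where k: "f = F k" by blast
    have "\<bar>Re (z ^ k)\<bar> \<le> 1 \<and> \<bar>Im (z ^ k)\<bar> \<le> 1" if "z \<in> Z" for z
    proof -
      have "norm (z ^ k) = 1" using normZ[OF that] by (simp add: norm_power)
      then show ?thesis using abs_Re_le_cmod[of "z ^ k"] abs_Im_le_cmod[of "z ^ k"] by simp
    qed
    then show "f \<in> Z \<rightarrow>\<^sub>E {-2..2} \<times> {-2..2}"
      unfolding k F_def using floor by (intro restrict_PiE[THEN iffD2] Pi_I) blast
  qed
  then have "finite (range F)"
    by (rule finite_subset) (intro finite_PiE fin; simp)
  then have "\<not> inj F" using finite_imageD by blast
  then obtain k l where kl: "k < l" "F k = F l" unfolding inj_def by (metis linorder_neqE_nat)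
  have close: "norm (z ^ l - z ^ k) < 1" if "z \<in> Z" for z
  proof -
    have "F k z = F l z" using kl(2) by simp
    then have "\<lfloor>2 * Re (z ^ k)\<rfloor> = \<lfloor>2 * Re (z ^ l)\<rfloor>" "\<lfloor>2 * Im (z ^ k)\<rfloor> = \<lfloor>2 * Im (z ^ l)\<rfloor>"
      using that by (simp_all add: F_def)
    then have "\<bar>2 * Re (z ^ l) - 2 * Re (z ^ k)\<bar> < 1" "\<bar>2 * Im (z ^ l) - 2 * Im (z ^ k)\<bar> < 1"
      by linarith+
    then have "\<bar>Re (z ^ l - z ^ k)\<bar> + \<bar>Im (z ^ l - z ^ k)\<bar> < 1" by auto
    then show ?thesis using cmod_le[of "z ^ l - z ^ k"] by linarith
  qed
  have "w ^ l - w ^ k = 0"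
  proof (rule algebraic_int_eq_0_if_conjugates_small)
    show "algebraic_int (w ^ l - w ^ k)" using w by (intro algebraic_int_diff algebraic_int_power)
    show "norm (\<sigma> (w ^ l - w ^ k)) < 1" if \<sigma>: "alg_hom \<sigma>" for \<sigma>
      using close[OF conj[OF \<sigma>]] alg
      by (simp add: alg_hom_diff[OF \<sigma>] alg_hom_power[OF \<sigma>] algebraic_power)
  qed
  moreover have "w \<noteq> 0" using norm[OF alg_hom_id] by auto
  moreover have "w ^ l = w ^ k * w ^ (l - k)" using kl(1) by (simp flip: power_add)
  ultimately have "w ^ (l - k) = 1" by simp
  then show ?thesis unfolding root_of_unity_def using kl(1) by (intro exI[of _ "l - k"]) simp
qed

lemma imaginary_unit_in_Z_tr_i: "\<i> \<in> Z_tr_i"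
proof -
  have "\<i> = 0 + 1 * \<i>" by simp
  then have "\<i> \<in> Q_tr_i" unfolding Q_tr_i_iff using Q_tr_0 Q_tr_1 by blast
  then show ?thesis by (simp add: Z_tr_i_iff)
qed

text \<open>Homomorphisms preserve roots of unity, whose inverses are their conjugates, so twice the
  real and twice the imaginary part are totally real. The doubling keeps them integral.\<close>

lemma root_of_unity_in_Z_tr_i:
  assumes "root_of_unity w"
  shows "w + cnj w \<in> Z_tr" "(w - cnj w) * (- \<i>) \<in> Z_tr" "w \<in> Z_tr_i"
proof -
  obtain n where n: "n > 0" "w ^ n = 1" using assms by (auto simp: root_of_unity_def)
  have int: "algebraic_int w" "algebraic_int (cnj w)"
    using root_of_unity_algebraic_int[OF assms] by auto
  then have alg: "algebraic w" "algebraic (cnj w)" by blast+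
  have inv: "w * cnj w = 1" using root_of_unity_mult_cnj[OF assms] .
  have \<sigma>cnj: "\<sigma> (cnj w) = cnj (\<sigma> w)" if \<sigma>: "alg_hom \<sigma>" for \<sigma>
  proof -
    have "\<sigma> w * \<sigma> (cnj w) = 1"
      using alg_hom_mult[OF \<sigma> alg] inv alg_hom_1[OF \<sigma>] by simp
    moreover have "root_of_unity (\<sigma> w)"
      using root_of_unity_alg_hom[OF \<sigma> alg(1) n(2)] n(1) by (auto simp: root_of_unity_def)
    then have "\<sigma> w * cnj (\<sigma> w) = 1" by (rule root_of_unity_mult_cnj)
    ultimately show ?thesis by (metis mult_left_cancel mult_zero_left zero_neq_one)
  qed
  have "\<sigma> (w + cnj w) \<in> \<real>" if \<sigma>: "alg_hom \<sigma>" for \<sigma>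
    unfolding alg_hom_add[OF \<sigma> alg] \<sigma>cnj[OF \<sigma>] by (simp add: Reals_cnj_iff add.commute)
  then show 1: "w + cnj w \<in> Z_tr" using int by (auto simp: Z_tr_iff Q_tr_iff)
  have "\<sigma> ((w - cnj w) * (- \<i>)) \<in> \<real>" if \<sigma>: "alg_hom \<sigma>" for \<sigma>
  proof -
    have "\<sigma> (- \<i>) = cnj (\<sigma> \<i>)"
      using alg_hom_cnj[OF \<sigma>, of \<i>] imaginary_unit_in_Z_tr_i by (simp add: Z_tr_i_iff)
    moreover have "\<sigma> (- \<i>) = - \<sigma> \<i>" using alg_hom_uminus[OF \<sigma>, of \<i>] by simp
    ultimately have i: "cnj (\<sigma> (- \<i>)) = - \<sigma> (- \<i>)" by (metis complex_cnj_cnj minus_minus)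
    have "algebraic (w - cnj w)"
      by (rule algebraic_int_imp_algebraic[OF algebraic_int_diff[OF int]])
    then have eq: "\<sigma> ((w - cnj w) * (- \<i>)) = (\<sigma> w - cnj (\<sigma> w)) * \<sigma> (- \<i>)"
      using alg_hom_mult[OF \<sigma>, of "w - cnj w" "- \<i>"] alg_hom_diff[OF \<sigma> alg] \<sigma>cnj[OF \<sigma>]
      by (metis algebraic_ii algebraic_minus)
    show ?thesis unfolding eq by (simp add: Reals_cnj_iff i algebra_simps)
  qed
  moreover have "algebraic_int ((w - cnj w) * (- \<i>))"
    using int by (intro algebraic_int_mult algebraic_int_diff) auto
  ultimately show 2: "(w - cnj w) * (- \<i>) \<in> Z_tr" by (auto simp only: Z_tr_iff Q_tr_iff)
  have "w = (w + cnj w) * inverse 2 + ((w - cnj w) * (- \<i>)) * inverse 2 * \<i>"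
    by (simp add: field_simps)
  moreover have "(w + cnj w) * inverse 2 \<in> Q_tr" "((w - cnj w) * (- \<i>)) * inverse 2 \<in> Q_tr"
    using Q_tr_mult[OF _ Q_tr_inverse[OF Q_tr_numeral]] 1 2 Z_tr_iff by blast+
  ultimately show "w \<in> Z_tr_i" unfolding Z_tr_i_iff Q_tr_i_iff using int(1) by blast
qed

text \<open>\<open>a\<close> and \<open>b\<close> are twice the coordinates of \<open>u\<close>, and
  \<open>j\<close> stands for \<i> or its negative, which the language of rings cannot tell apart.
  The equation \<open>a\<^sup>2 + b\<^sup>2 = 4\<close> persists under homomorphisms, so all
  conjugates of \<open>u\<close> have norm 1 and Kronecker's theorem applies.\<close>

lemma root_of_unity_characterization:
  assumes "u \<in> Z_tr_i"
  shows "root_of_unity u \<longleftrightarrow>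
    (\<exists>a\<in>Z_tr. \<exists>b\<in>Z_tr. \<exists>j\<in>Z_tr_i. j\<^sup>2 = - 1 \<and> 2 * u = a + b * j \<and> a\<^sup>2 + b\<^sup>2 = 4)"
proof
  assume u: "root_of_unity u"
  have "2 * u = (u + cnj u) + (u - cnj u) * (- \<i>) * \<i>" by (simp add: algebra_simps)
  moreover have "(u + cnj u)\<^sup>2 + ((u - cnj u) * (- \<i>))\<^sup>2 = 4 * (u * cnj u)"
    by (simp add: algebra_simps power2_eq_square)
  moreover have "u * cnj u = 1" using root_of_unity_mult_cnj[OF u] .
  ultimately show "\<exists>a\<in>Z_tr. \<exists>b\<in>Z_tr. \<exists>j\<in>Z_tr_i. j\<^sup>2 = - 1 \<and> 2 * u = a + b * j \<and> a\<^sup>2 + b\<^sup>2 = 4"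
    using root_of_unity_in_Z_tr_i[OF u] imaginary_unit_in_Z_tr_i
    by (intro bexI[of _ "u + cnj u"] bexI[of _ "(u - cnj u) * (- \<i>)"] bexI[of _ \<i>]) simp_all
next
  assume "\<exists>a\<in>Z_tr. \<exists>b\<in>Z_tr. \<exists>j\<in>Z_tr_i. j\<^sup>2 = - 1 \<and> 2 * u = a + b * j \<and> a\<^sup>2 + b\<^sup>2 = 4"
  then obtain a b j where ab: "a \<in> Z_tr" "b \<in> Z_tr"
    and j: "j \<in> Z_tr_i" "j\<^sup>2 = - 1" "2 * u = a + b * j" "a\<^sup>2 + b\<^sup>2 = 4"
    by blast
  then have abj: "a \<in> Q_tr" "b \<in> Q_tr" "j \<in> Z_tr_i" "j\<^sup>2 = - 1" "2 * u = a + b * j" "a\<^sup>2 + b\<^sup>2 = 4"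
    using Z_tr_iff by auto
  have alg: "algebraic a" "algebraic b" "algebraic j" "algebraic u" "algebraic (2::complex)"
    using abj(1-3) Q_tr_algebraic assms Z_tr_i_iff by (auto intro: rat_imp_algebraic)
  show "root_of_unity u"
  proof (rule root_of_unity_if_conjugates_norm_1)
    show "algebraic_int u" using assms by (simp add: Z_tr_i_iff)
    fix \<sigma> assume \<sigma>: "alg_hom \<sigma>"
    obtain r where r: "\<sigma> a = of_real r" using Q_tr_alg_hom_real[OF abj(1) \<sigma>] by (rule Reals_cases)
    obtain s where s: "\<sigma> b = of_real s" using Q_tr_alg_hom_real[OF abj(2) \<sigma>] by (rule Reals_cases)
    have "\<sigma> (j\<^sup>2) = - 1" unfolding abj(4) using alg_hom_of_int[OF \<sigma>, of "- 1"] by simp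
    then have "(\<sigma> j)\<^sup>2 = \<i>\<^sup>2" using alg_hom_power[OF \<sigma> alg(3), of 2] by simp
    then have j: "\<sigma> j = \<i> \<or> \<sigma> j = - \<i>" unfolding power2_eq_iff .
    have "\<sigma> (2 * u) = \<sigma> a + \<sigma> b * \<sigma> j"
      unfolding abj(5) using alg by (simp add: alg_hom_add[OF \<sigma>] alg_hom_mult[OF \<sigma>] algebraic_mult)
    then have eq: "2 * \<sigma> u = of_real r + of_real s * \<sigma> j"
      using alg alg_hom_of_nat[OF \<sigma>, of 2] by (simp add: alg_hom_mult[OF \<sigma>] r s)
    have "\<sigma> (a\<^sup>2 + b\<^sup>2) = 4" unfolding abj(6) using alg_hom_of_nat[OF \<sigma>, of 4] by simp
    then have "of_real (r\<^sup>2 + s\<^sup>2) = (of_real 4 :: complex)"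
      using alg by (simp add: alg_hom_add[OF \<sigma>] alg_hom_power[OF \<sigma>] algebraic_power r s)
    then have rs: "r\<^sup>2 + s\<^sup>2 = 4" by (simp only: of_real_eq_iff)
    have "norm (2 * \<sigma> u) = sqrt (r\<^sup>2 + s\<^sup>2)" unfolding eq using j by (auto simp: cmod_def)
    also have "\<dots> = 2" unfolding rs using real_sqrt_four by simp
    finally show "norm (\<sigma> u) = 1" by (simp add: norm_mult)
  qed
qed

section \<open>Definability of the natural numbers\<close>

text \<open>Divisibility in the ring of all algebraic integers, so that quotients and conjugates
  need not be located in a particular field.\<close>

definition aint_dvd :: "complex \<Rightarrow> complex \<Rightarrow> bool" where
  "aint_dvd x y \<longleftrightarrow> (\<exists>c. algebraic_int c \<and> y = x * c)"

lemma aint_dvdI: "algebraic_int c \<Longrightarrow> y = x * c \<Longrightarrow> aint_dvd x y"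
  unfolding aint_dvd_def by blast

lemma aint_dvdE:
  assumes "aint_dvd x y"
  obtains c where "algebraic_int c" "y = x * c"
  using assms unfolding aint_dvd_def by blast

lemma aint_dvd_trans:
  assumes "aint_dvd x y" "aint_dvd y z"
  shows "aint_dvd x z"
proof -
  obtain c where c: "algebraic_int c" "y = x * c" using assms(1) by (rule aint_dvdE)
  obtain d where d: "algebraic_int d" "z = y * d" using assms(2) by (rule aint_dvdE)
  show ?thesis
  proof (rule aint_dvdI)
    show "algebraic_int (c * d)" using c(1) d(1) by blast
  qed (simp add: c(2) d(2) mult.assoc)
qed

lemma aint_dvd_add:
  assumes "aint_dvd x y" "aint_dvd x z"
  shows "aint_dvd x (y + z)"
proof -
  obtain c where c: "algebraic_int c" "y = x * c" using assms(1) by (rule aint_dvdE)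
  obtain d where d: "algebraic_int d" "z = x * d" using assms(2) by (rule aint_dvdE)
  show ?thesis
  proof (rule aint_dvdI)
    show "algebraic_int (c + d)" using c(1) d(1) by blast
  qed (simp add: c(2) d(2) distrib_left)
qed

lemma aint_dvd_diff:
  assumes "aint_dvd x y" "aint_dvd x z"
  shows "aint_dvd x (y - z)"
proof -
  obtain c where c: "algebraic_int c" "y = x * c" using assms(1) by (rule aint_dvdE)
  obtain d where d: "algebraic_int d" "z = x * d" using assms(2) by (rule aint_dvdE)
  show ?thesis
  proof (rule aint_dvdI)
    show "algebraic_int (c - d)" using c(1) d(1) by blast
  qed (simp add: c(2) d(2) right_diff_distrib)
qed

lemma aint_dvd_mult:
  assumes "aint_dvd x y" "algebraic_int d"
  shows "aint_dvd x (y * d)"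
proof -
  obtain c where c: "algebraic_int c" "y = x * c" using assms(1) by (rule aint_dvdE)
  show ?thesis
  proof (rule aint_dvdI)
    show "algebraic_int (c * d)" using c(1) assms(2) by blast
  qed (simp add: c(2)  mult.assoc)
qed

lemma aint_dvd_power: "aint_dvd x y \<Longrightarrow> aint_dvd (x ^ n) (y ^ n)"
  by (elim aint_dvdE) (auto intro!: aint_dvdI[OF algebraic_int_power] simp: power_mult_distrib)

text \<open>A rational quotient that is an algebraic integer is an integer; this returns
  contradictions to ordinary arithmetic.\<close>

lemma aint_dvd_of_int_iff: "aint_dvd (of_int a) (of_int b) \<longleftrightarrow> a dvd b"
proof
  assume "aint_dvd (of_int a) (of_int b)"
  then obtain c :: complex where c: "algebraic_int c" "of_int b = of_int a * c" by (rule aint_dvdE)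
  show "a dvd b"
  proof (cases "a = 0")
    case False
    then have "c = of_int b / of_int a" using c(2) by simp
    then have "c \<in> \<rat>" by simp
    then have "c \<in> \<int>" using c(1) by (rule rational_algebraic_int_is_int[rotated])
    then obtain k where "c = of_int k" by (rule Ints_cases)
    then have "of_int b = (of_int (a * k) :: complex)" using c(2) by simp
    then show ?thesis unfolding of_int_eq_iff by simp
  qed (use c in simp)
next
  assume "a dvd b"
  then obtain k where "b = a * k" by (rule dvdE)
  then show "aint_dvd (of_int a) (of_int b)"
    by (intro aint_dvdI[OF algebraic_int_of_int[of k]]) simp
qed

lemma aint_dvd_of_nat_iff: "aint_dvd (of_nat a) (of_nat b) \<longleftrightarrow> a dvd b"
  using aint_dvd_of_int_iff[of "int a" "int b"] by simp

section \<open>Roots of unity modulo z - 1\<close>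

lemma aint_dvd_minus_1_power:
  assumes "algebraic_int z"
  shows "aint_dvd (z - 1) (z ^ n - 1)"
proof (rule aint_dvdI)
  show "z ^ n - 1 = (z - 1) * (\<Sum>i<n. z ^ i)" by (rule power_diff_1_eq)
  show "algebraic_int (\<Sum>i<n. z ^ i)" using assms by (intro algebraic_int_sum algebraic_int_power)
qed

text \<open>The powers of \<open>z\<close> with exponents below \<open>n\<close> sum to 0, while
  each of them is congruent to 1 modulo \<open>z - 1\<close>.\<close>

lemma root_of_unity_minus_1_dvd:
  assumes "z ^ n = 1" "z \<noteq> 1" "n > 0"
  shows "aint_dvd (z - 1) (of_nat n)"
proof -
  have z: "algebraic_int z" using assms root_of_unity_algebraic_int root_of_unity_def by blast
  have "aint_dvd (z - 1) (\<Sum>i\<in>I. z ^ i - 1)" for I :: "nat set"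
  proof (induction I rule: infinite_finite_induct)
    case (insert i I)
    then show ?case using aint_dvd_add aint_dvd_minus_1_power[OF z] by simp
  qed (auto intro: aint_dvdI[of 0])
  then have "aint_dvd (z - 1) (\<Sum>i<n. z ^ i - 1)" .
  moreover have "(\<Sum>i<n. z ^ i) = 0"
    using power_diff_1_eq[of z n] assms by simp
  then have "(\<Sum>i<n. z ^ i - 1) = - of_nat n" by (simp add: sum_subtractf)
  ultimately have "aint_dvd (z - 1) (- of_nat n * (- 1))"
    using aint_dvd_mult[of _ "- of_nat n" "- 1"] algebraic_int_of_int[of "- 1"] by simp
  then show ?thesis by simp
qed

lemma power_prime_expand:
  fixes l :: complex
  assumes "prime p" "algebraic_int l"
  shows "\<exists>e. algebraic_int e \<and> (1 + l) ^ p - 1 = l ^ p + of_nat p * l * e"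
proof -
  define c where "c k = (p choose k) div p" for k
  have p: "p > 1" using assms(1) prime_gt_1_nat by blast
  have c: "(p choose k) = p * c k" if "0 < k" "k < p" for k
    using that assms(1) dvd_choose_prime[of k p] unfolding c_def by simp
  define e where "e = (\<Sum>k\<in>{1..<p}. of_nat (c k) * l ^ (k - 1))"
  have "(1 + l) ^ p = (l + 1) ^ p" by (simp add: add.commute)
  also have "\<dots> = (\<Sum>k\<le>p. of_nat (p choose k) * l ^ k)" by (simp add: binomial_ring)
  also have "{..p} = insert 0 (insert p {1..<p})" using p by auto
  also have "(\<Sum>k\<in>\<dots>. of_nat (p choose k) * l ^ k) = 1 + (l ^ p + (\<Sum>k\<in>{1..<p}. of_nat (p choose k) * l ^ k))"
    using p by simp
  also have "(\<Sum>k\<in>{1..<p}. of_nat (p choose k) * l ^ k) = of_nat p * l * e"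
    unfolding e_def sum_distrib_left
  proof (rule sum.cong)
    fix k assume k: "k \<in> {1..<p}"
    then have "l ^ k = l * l ^ (k - 1)" by (simp flip: power_Suc)
    then show "of_nat (p choose k) * l ^ k = of_nat p * l * (of_nat (c k) * l ^ (k - 1))"
      using c[of k] k by simp
  qed simp
  finally have "(1 + l) ^ p - 1 = l ^ p + of_nat p * l * e" by simp
  moreover have "algebraic_int e"
    unfolding e_def
    by (intro algebraic_int_sum algebraic_int_mult algebraic_int_power algebraic_int_of_nat assms(2))
  ultimately show ?thesis by blast
qed

text \<open>Expanding the \<open>p\<close>-th power of 1 + (z - 1) and cancelling
  \<open>z - 1\<close> makes its power of exponent \<open>p - 1\<close> a multiple of
  \<open>p\<close>. If \<open>z - 1\<close> were a unit, so would be \<open>p\<close>.\<close>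

lemma prime_root_of_unity_minus_1:
  assumes p: "prime p" and z: "z ^ p = 1" "z \<noteq> 1"
  shows "aint_dvd (of_nat p) ((z - 1) ^ (p - 1))" "\<not> aint_dvd (z - 1) 1"
proof -
  have p1: "p > 1" using p prime_gt_1_nat by blast
  have "root_of_unity z" using z(1) p1 unfolding root_of_unity_def by (intro exI[of _ p]) simp
  then have "algebraic_int (z - 1)"
    by (intro algebraic_int_diff root_of_unity_algebraic_int algebraic_int_1)
  from power_prime_expand[OF p this] obtain e where
    e: "algebraic_int e" "0 = (z - 1) ^ p + of_nat p * (z - 1) * e" using z by auto
  have "(z - 1) * ((z - 1) ^ (p - 1) + of_nat p * e) = (z - 1) * (z - 1) ^ (p - 1) + of_nat p * (z - 1) * e"
    by (simp only: distrib_left mult_ac)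
  also have "(z - 1) * (z - 1) ^ (p - 1) = (z - 1) ^ p" using p1 by (simp flip: power_Suc)
  finally have "(z - 1) * ((z - 1) ^ (p - 1) + of_nat p * e) = 0" using e(2) by simp
  then have "(z - 1) ^ (p - 1) = of_nat p * (- e)" using z(2) by (simp add: eq_neg_iff_add_eq_0)
  then show *: "aint_dvd (of_nat p) ((z - 1) ^ (p - 1))" using e(1) by (intro aint_dvdI[of "- e"]) auto
  show "\<not> aint_dvd (z - 1) 1"
  proof
    assume "aint_dvd (z - 1) 1"
    then have "aint_dvd ((z - 1) ^ (p - 1)) (1 ^ (p - 1))" by (rule aint_dvd_power)
    then have "aint_dvd (of_nat p) (of_nat 1)" using aint_dvd_trans[OF *] by simp
    then show False unfolding aint_dvd_of_nat_iff using p1 by simp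
  qed
qed

text \<open>By Bezout, no exponent strictly between 0 and \<open>p\<close> sends \<open>z\<close> to
  1, so the first \<open>p\<close> powers of \<open>z\<close> are distinct and exhaust the
  \<open>p\<close>-th roots of unity.\<close>

lemma prime_roots_of_unity_powers:
  fixes z :: complex
  assumes p: "prime p" and z: "z ^ p = 1" "z \<noteq> 1" and w: "w ^ p = 1"
  shows "\<exists>k. w = z ^ k"
proof -
  have p1: "p > 1" using p prime_gt_1_nat by blast
  have z0: "z \<noteq> 0" using z(1) p1 by (auto simp: power_0_left)
  have ord: False if "z ^ d = 1" "0 < d" "d < p" for d
  proof -
    have "coprime d p" using p that(2,3) by (metis coprime_commute nat_dvd_not_less prime_imp_coprime)
    then obtain x y where "d * x = p * y + 1" using coprime_bezout_strong[of d p] p1 by fastforce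
    then have "z ^ (d * x) = z ^ (p * y) * z" by simp
    then show False using that(1) z by (simp add: power_mult)
  qed
  have "inj_on (\<lambda>k. z ^ k) {..<p}"
  proof (rule linorder_inj_onI')
    fix i j assume ij: "i \<in> {..<p}" "j \<in> {..<p}" "i < j"
    have "z ^ j = z ^ i * z ^ (j - i)" using ij(3) by (simp flip: power_add)
    moreover have "z ^ (j - i) \<noteq> 1" using ord[of "j - i"] ij by (simp add: less_imp_diff_less) blast
    ultimately show "z ^ i \<noteq> z ^ j" using z0 by simp
  qed
  then have card: "card ((\<lambda>k. z ^ k) ` {..<p}) = p" by (simp add: card_image)
  have "(\<lambda>k. z ^ k) ` {..<p} \<subseteq> {w. w ^ p = 1}"
  proof
    fix x assume "x \<in> (\<lambda>k. z ^ k) ` {..<p}"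
    then obtain k where "x = z ^ k" by blast
    then have "x ^ p = (z ^ p) ^ k" by (metis mult.commute power_mult)
    then show "x \<in> {w. w ^ p = 1}" using z(1) by simp
  qed
  then have "(\<lambda>k. z ^ k) ` {..<p} = {w. w ^ p = 1}"
    using finite_roots_unity[of p] card_roots_unity_eq[of p] card p1
    by (intro card_subset_eq) auto
  then show ?thesis using w by blast
qed

text \<open>A part of the order of \<open>u\<close> prime to \<open>p\<close> would make
  \<open>z - 1\<close> divide both \<open>p\<close> and an integer prime to \<open>p\<close>, hence
  1. An order divisible by the square of \<open>p\<close> would make \<open>z\<close> a power of
  some v^p with v congruent to 1 modulo \<open>z - 1\<close>; but v^p - 1 is divisible by the square
  of \<open>z - 1\<close>, and then so is \<open>z - 1\<close> itself.\<close>

lemma root_of_unity_congruent_1: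
  assumes p: "prime p" and z: "z ^ p = 1" "z \<noteq> 1"
    and u: "root_of_unity u" "aint_dvd (z - 1) (u - 1)"
  shows "u ^ p = 1"
proof -
  have p1: "p > 1" using p prime_gt_1_nat by blast
  have intu: "algebraic_int u" using u(1) by (rule root_of_unity_algebraic_int)
  have dvd_pow: "aint_dvd (z - 1) (u ^ n - 1)" for n
    using aint_dvd_trans[OF u(2) aint_dvd_minus_1_power[OF intu]] .
  note dvd_p = root_of_unity_minus_1_dvd[OF z]
  obtain m where m: "m > 0" "u ^ m = 1" using u(1) by (auto simp: root_of_unity_def)
  obtain a m' where am: "m = p ^ a * m'" "\<not> p dvd m'"
    using prime_power_canonical[OF p m(1)] by (metis mult.commute)
  have "u ^ (p ^ a) = 1"
  proof (rule ccontr)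
    assume ne: "u ^ (p ^ a) \<noteq> 1"
    have "(u ^ (p ^ a)) ^ m' = 1" "m' > 0" using m am by (simp_all flip: power_mult) 
    then have "aint_dvd (u ^ (p ^ a) - 1) (of_nat m')" using ne root_of_unity_minus_1_dvd by blast
    then have m': "aint_dvd (z - 1) (of_nat m')" by (rule aint_dvd_trans[OF dvd_pow])
    have "coprime m' p" using am(2) p by (metis coprime_commute prime_imp_coprime)
    then obtain x y where xy: "m' * x = p * y + 1" using coprime_bezout_strong[of m' p] p1 by fastforce
    have "aint_dvd (z - 1) (of_nat m' * of_nat x - of_nat p * of_nat y)"
      using m' dvd_p p1 by (intro aint_dvd_diff aint_dvd_mult algebraic_int_of_nat) auto
    moreover have "of_nat m' * of_nat x - of_nat p * of_nat y = (1 :: complex)"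
      using arg_cong[OF xy, of "of_nat :: nat \<Rightarrow> complex"] by simp
    ultimately show False using prime_root_of_unity_minus_1(2)[OF p z] by simp
  qed
  \<comment> \<open>The exponent \<open>a\<close> is lowered one step at a time while it is at least
    2.\<close>
  then show ?thesis
  proof (induction a)
    case (Suc a)
    show ?case
    proof (cases a)
      case 0
      then show ?thesis using Suc.prems by simp
    next
      case a: (Suc b)
      define v where "v = u ^ (p ^ b)"
      define l where "l = v - 1"
      have vp: "v ^ p = u ^ (p ^ a)" unfolding v_def a by (simp add: mult.commute flip: power_mult)
      have "(v ^ p) ^ p = 1" using Suc.prems unfolding vp by (simp add: mult.commute flip: power_mult)
      have "v ^ p = 1"
      proof (rule ccontr)
        assume ne: "v ^ p \<noteq> 1"
        obtain k where k: "z = (v ^ p) ^ k"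
          using prime_roots_of_unity_powers[OF p \<open>(v ^ p) ^ p = 1\<close> ne z(1)] by blast
        have intv: "algebraic_int v" unfolding v_def using intu by (rule algebraic_int_power)
        then obtain c where c: "algebraic_int c" "z - 1 = (v ^ p - 1) * c"
          using aint_dvd_minus_1_power[OF algebraic_int_power, of v p k] unfolding k[symmetric]
          by (blast elim: aint_dvdE)
        obtain f where f: "algebraic_int f" "l = (z - 1) * f"
          unfolding l_def v_def using dvd_pow by (rule aint_dvdE)
        obtain g where g: "algebraic_int g" "of_nat p = (z - 1) * g"
          using dvd_p p1 by (auto elim: aint_dvdE)
        have intl: "algebraic_int l" unfolding l_def using intv algebraic_int_1 by blast
        obtain e where e: "algebraic_int e" "(1 + l) ^ p - 1 = l ^ p + of_nat p * l * e"
          using power_prime_expand[OF p intl] by blast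
        have z': "z - 1 \<noteq> 0" using z(2) by simp
        \<comment> \<open>\<open>q\<close> is the cofactor left after two factors
          \<open>z - 1\<close> are taken out of \<open>(v ^ p - 1) * c\<close>: one pair comes from
          \<open>l ^ p\<close>, as p \<ge> 2, the other from \<open>p\<close> and
          \<open>l\<close>.\<close>
        define q where "q = ((z - 1) ^ (p - 2) * f ^ p + g * f * e) * c"
        have "v ^ p - 1 = (1 + l) ^ p - 1" by (simp add: l_def)
        also have "\<dots> = (z - 1) ^ p * f ^ p + (z - 1) * g * ((z - 1) * f) * e"
          unfolding e(2) g(2) unfolding f(2) by (simp add: power_mult_distrib)
        also have "(z - 1) ^ p = (z - 1) * (z - 1) * (z - 1) ^ (p - 2)"
          using p1 by (simp flip: power_Suc add: mult.assoc Suc_diff_Suc numeral_2_eq_2)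
        finally have vp1: "v ^ p - 1 = (z - 1) * (z - 1) * (z - 1) ^ (p - 2) * f ^ p + (z - 1) * g * ((z - 1) * f) * e" .
        have "(x * x * y * f ^ p + x * g * (x * f) * e) * c = x * (x * ((y * f ^ p + g * f * e) * c))" for x y
          by (simp add: algebra_simps)
        then have "z - 1 = (z - 1) * ((z - 1) * q)"
          unfolding q_def using c(2)[unfolded vp1] by metis
        then have "1 = (z - 1) * q" using z' by simp
        moreover have "root_of_unity z" using z(1) p1 unfolding root_of_unity_def by (intro exI[of _ p]) simp
        then have "algebraic_int (z - 1)"
          by (intro algebraic_int_diff root_of_unity_algebraic_int algebraic_int_1)
        then have "algebraic_int q"
          unfolding q_def using f(1) g(1) e(1) c(1)
          by (intro algebraic_int_mult algebraic_int_add algebraic_int_power)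
        ultimately have "aint_dvd (z - 1) 1" by (blast intro: aint_dvdI)
        then show False using prime_root_of_unity_minus_1(2)[OF p z] by blast
      qed
      then show ?thesis using Suc.IH vp by simp
    qed
  qed (use m in simp)
qed

text \<open>In an integer polynomial vanishing at \<open>d\<close> all terms but the constant one
  are multiples of \<open>d\<close>.\<close>

lemma algebraic_int_dvd_nonzero_int:
  assumes "algebraic_int (d :: complex)" "d \<noteq> 0"
  shows "\<exists>N::int. N \<noteq> 0 \<and> aint_dvd d (of_int N)"
proof -
  have "algebraic d" using assms(1) by blast
  then obtain p where p: "coeff p 0 \<noteq> 0" "poly (map_poly of_int p) d = 0"
    using assms(2) by (rule algebraicE'_nonzero)
  obtain a q where aq: "p = pCons a q" by (cases p)
  have "algebraic_int (poly (map_poly of_int q) d)"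
    unfolding poly_altdef using assms(1)
    by (intro algebraic_int_sum algebraic_int_mult algebraic_int_power)
       (simp_all add: coeff_map_poly algebraic_int_of_int)
  moreover have "map_poly of_int p = pCons (of_int a) (map_poly of_int q :: complex poly)"
    unfolding aq by (rule poly_eqI) (simp add: coeff_map_poly coeff_pCons split: nat.split)
  then have "of_int a = d * (- poly (map_poly of_int q) d)"
    using p(2) by (simp add: eq_neg_iff_add_eq_0)
  ultimately have "aint_dvd d (of_int a)" by (intro aint_dvdI[of "- poly (map_poly of_int q) d"]) auto
  then show ?thesis using p(1) aq by (intro exI[of _ a]) simp
qed

text \<open>The cofactor is kept in \<open>Z_tr_i\<close>, because the first-order condition
  quantifies over that ring.\<close>

lemma power_minus_1_expand:
  assumes zO: "z \<in> Z_tr_i"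
  shows "\<exists>w\<in>Z_tr_i. z ^ n - 1 - of_nat n * (z - 1) = w * (z - 1)\<^sup>2"
proof (induction n)
  case 0
  then show ?case using Z_tr_i_0 by force
next
  case (Suc n)
  then obtain w where w: "w \<in> Z_tr_i" "z ^ n - 1 - of_nat n * (z - 1) = w * (z - 1)\<^sup>2" by blast
  have "z ^ Suc n - 1 - of_nat (Suc n) * (z - 1)
      = z * (z ^ n - 1 - of_nat n * (z - 1)) + of_nat n * (z - 1)\<^sup>2"
    by (simp add: algebra_simps power2_eq_square)
  then have "z ^ Suc n - 1 - of_nat (Suc n) * (z - 1) = (z * w + of_nat n) * (z - 1)\<^sup>2"
    unfolding w(2) by (simp add: algebra_simps)
  then show ?case using Z_tr_i_add[OF Z_tr_i_mult[OF zO w(1)] Z_tr_i_of_nat] by blast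
qed

text \<open>The condition comes from \<open>z ^ n - 1 \<equiv> n (z - 1)\<close> modulo \<open>(z - 1)\<^sup>2\<close>.\<close>

definition integer_condition :: "complex \<Rightarrow> bool" where
  "integer_condition y \<longleftrightarrow> (\<forall>z. root_of_unity z \<longrightarrow> z \<noteq> 1 \<longrightarrow>
     (\<exists>u w. root_of_unity u \<and> w \<in> Z_tr_i \<and> u - 1 - y * (z - 1) = w * (z - 1)\<^sup>2))"

lemma integer_condition_of_nat: "integer_condition (of_nat n)"
  unfolding integer_condition_def
proof (intro allI impI)
  fix z assume z: "root_of_unity z" "z \<noteq> 1"
  have zO: "z \<in> Z_tr_i" using root_of_unity_in_Z_tr_i(3)[OF z(1)] .
  have "\<exists>w\<in>Z_tr_i. z ^ n - 1 - of_nat n * (z - 1) = w * (z - 1)\<^sup>2"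
    by (rule power_minus_1_expand[OF zO])
  moreover obtain m where m: "m > 0" "z ^ m = 1" using z(1) unfolding root_of_unity_def by blast
  have "(z ^ n) ^ m = (z ^ m) ^ n" by (metis mult.commute power_mult)
  then have "root_of_unity (z ^ n)" using m unfolding root_of_unity_def by auto
  ultimately show "\<exists>u w. root_of_unity u \<and> w \<in> Z_tr_i \<and> u - 1 - of_nat n * (z - 1) = w * (z - 1)\<^sup>2"
    by blast
qed

text \<open>Up to units \<open>z - 1\<close> is invariant under conjugation, so \<open>y\<close> and all its conjugates are
  congruent to the same integer modulo \<open>z - 1\<close>.\<close>

lemma integer_condition_congruent:
  assumes y: "algebraic_int y" "integer_condition y" and \<sigma>: "alg_hom \<sigma>"
    and p: "prime p" and z: "z ^ p = 1" "z \<noteq> 1"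
  shows "aint_dvd (z - 1) (y - \<sigma> y)"
proof -
  have p1: "p > 1" using p prime_gt_1_nat by blast
  then have zr: "root_of_unity z" using z unfolding root_of_unity_def by (intro exI[of _ p]) simp
  then obtain u w where u: "root_of_unity u" and w: "w \<in> Z_tr_i"
    and uw: "u - 1 - y * (z - 1) = w * (z - 1)\<^sup>2"
    using y(2) z(2) unfolding integer_condition_def by blast
  have intz: "algebraic_int z" "algebraic_int (z - 1)"
    using root_of_unity_algebraic_int[OF zr] algebraic_int_1 by blast+
  have intw: "algebraic_int w" using w by (simp add: Z_tr_i_iff)
  have eq: "u - 1 = (z - 1) * (y + w * (z - 1))" using uw by (simp add: algebra_simps power2_eq_square)
  moreover have "algebraic_int (y + w * (z - 1))" using y(1) intw intz by blast
  ultimately have "aint_dvd (z - 1) (u - 1)" by (intro aint_dvdI)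
  then have "u ^ p = 1" using root_of_unity_congruent_1[OF p z u] by blast
  then obtain k where k: "u = z ^ k" using prime_roots_of_unity_powers[OF p z] by blast
  obtain h where hO: "h \<in> Z_tr_i" and hk: "z ^ k - 1 - of_nat k * (z - 1) = h * (z - 1)\<^sup>2"
    using power_minus_1_expand[OF root_of_unity_in_Z_tr_i(3)[OF zr]] by blast
  have h: "algebraic_int h" "z ^ k - 1 = (z - 1) * (of_nat k + h * (z - 1))"
    using hO hk by (simp_all add: Z_tr_i_iff algebra_simps power2_eq_square)
  \<comment> \<open>Both sides are \<open>u - 1\<close>; cancelling \<open>z - 1\<close> leaves
    \<open>y\<close> congruent to \<open>k\<close>.\<close>
  have "(z - 1) * (y + w * (z - 1)) = (z - 1) * (of_nat k + h * (z - 1))" by (simp only: eq[symmetric] h(2)[symmetric] k)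
  then have "y + w * (z - 1) = of_nat k + h * (z - 1)" using z(2) by simp
  then have yk: "y = of_nat k + (z - 1) * (h - w)" by (simp add: algebra_simps)
  have inthw: "algebraic_int (h - w)" using h(1) intw by blast
  have alg: "algebraic z" "algebraic (z - 1)" "algebraic (h - w)" "algebraic (of_nat k :: complex)" "algebraic (1 :: complex)"
    using intz inthw algebraic_int_of_nat algebraic_int_1 by blast+
  have \<sigma>y: "\<sigma> y = of_nat k + (\<sigma> z - 1) * \<sigma> (h - w)"
    unfolding yk using alg
    by (simp add: alg_hom_add[OF \<sigma>] alg_hom_mult[OF \<sigma>] alg_hom_of_nat[OF \<sigma>] algebraic_mult)
       (simp add: alg_hom_diff[OF \<sigma>] alg_hom_1[OF \<sigma>])
  have "\<sigma> z ^ p = 1" using root_of_unity_alg_hom[OF \<sigma> alg(1) z(1)] .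
  then obtain j where j: "\<sigma> z = z ^ j" using prime_roots_of_unity_powers[OF p z] by blast
  have "aint_dvd (z - 1) ((\<sigma> z - 1) * \<sigma> (h - w))"
    unfolding j using intz(1) alg_hom_algebraic_int[OF \<sigma> inthw]
    by (intro aint_dvd_mult aint_dvd_minus_1_power)
  moreover have "aint_dvd (z - 1) ((z - 1) * (h - w))" using inthw by (intro aint_dvdI) auto
  moreover have "y - \<sigma> y = (z - 1) * (h - w) - (\<sigma> z - 1) * \<sigma> (h - w)" unfolding \<sigma>y using yk by simp
  ultimately show ?thesis using aint_dvd_diff by simp
qed

text \<open>If some conjugate differs from \<open>y\<close>, the difference divides an integer
  \<open>N\<close> other than 0. For a prime \<open>p\<close> above the absolute value of
  \<open>N\<close>, \<open>z - 1\<close> divides \<open>N\<close>; raising to the power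
  \<open>p - 1\<close> turns this into divisibility by \<open>p\<close>, which is
  impossible.\<close>

lemma integer_condition_imp_Ints:
  assumes y: "algebraic_int y" "integer_condition y"
  shows "y \<in> \<int>"
proof (rule algebraic_int_in_Ints_if_conjugates_eq[OF y(1)], rule ccontr)
  fix \<sigma> assume \<sigma>: "alg_hom \<sigma>" and ne: "\<sigma> y \<noteq> y"
  have "algebraic_int (y - \<sigma> y)" using y(1) alg_hom_algebraic_int[OF \<sigma> y(1)] by blast
  moreover have "y - \<sigma> y \<noteq> 0" using ne by simp
  ultimately obtain N :: int where N: "N \<noteq> 0" "aint_dvd (y - \<sigma> y) (of_int N)"
    using algebraic_int_dvd_nonzero_int by blast
  obtain p where p: "prime p" "p > nat \<bar>N\<bar>" using bigger_prime by blast
  have p1: "p > 1" using p(1) prime_gt_1_nat by blast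
  have "card {z::complex. z ^ p = 1} = p" using p1 by (intro card_roots_unity_eq) simp
  then have "\<not> {z::complex. z ^ p = 1} \<subseteq> {1}"
    using p1 card_mono[of "{1::complex}" "{z. z ^ p = 1}"] by auto
  then obtain z :: complex where z: "z ^ p = 1" "z \<noteq> 1" by blast
  have "aint_dvd (z - 1) (of_int N)"
    using aint_dvd_trans[OF integer_condition_congruent[OF y \<sigma> p(1) z] N(2)] .
  then have "aint_dvd ((z - 1) ^ (p - 1)) (of_int N ^ (p - 1))" by (rule aint_dvd_power)
  then have "aint_dvd (of_int (int p)) (of_int (N ^ (p - 1)))"
    using aint_dvd_trans[OF prime_root_of_unity_minus_1(1)[OF p(1) z]] by simp
  then have "int p dvd N ^ (p - 1)" unfolding aint_dvd_of_int_iff .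
  then have "int p dvd N" using p(1) by (metis prime_dvd_power prime_nat_int_transfer)
  then have "int p \<le> \<bar>N\<bar>" using N(1) by (intro zdvd_imp_le) auto
  then show False using p(2) by linarith
qed

text \<open>The square condition fixes the sign: square roots of natural numbers are totally real,
  while a negative integer has no real square root.\<close>

lemma Nats_characterization:
  assumes "y \<in> Z_tr_i"
  shows "y \<in> \<nat> \<longleftrightarrow> integer_condition y \<and> (\<exists>r\<in>Z_tr. r\<^sup>2 = y)"
proof
  assume "y \<in> \<nat>"
  then obtain n where n: "y = of_nat n" by (rule Nats_cases)
  have "\<exists>r\<in>Z_tr. r\<^sup>2 = y"
    unfolding n by (rule Z_tr_sqrt[OF Z_tr_of_nat]) (simp add: alg_hom_of_nat)
  then show "integer_condition y \<and> (\<exists>r\<in>Z_tr. r\<^sup>2 = y)" using integer_condition_of_nat[of n] n by simp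
next
  assume *: "integer_condition y \<and> (\<exists>r\<in>Z_tr. r\<^sup>2 = y)"
  then have "y \<in> \<int>" using integer_condition_imp_Ints assms Z_tr_i_iff by blast
  then obtain k where k: "y = of_int k" by (rule Ints_cases)
  obtain r where r: "r \<in> Z_tr" "r\<^sup>2 = y" using * by blast
  have "r \<in> \<real>" using r(1) Z_tr_iff_real by blast
  then obtain s where "r = of_real s" by (rule Reals_cases)
  then have "of_real (s\<^sup>2) = (of_real (of_int k) :: complex)" using r(2) k by simp
  then have "s\<^sup>2 = of_int k" unfolding of_real_eq_iff .
  then have "0 \<le> k" by (metis of_int_0_le_iff zero_le_power2)
  then have "y = of_nat (nat k)" using k by simp
  then show "y \<in> \<nat>" by simp
qed

section \<open>Undecidability of arithmetic\<close>

text \<open>Goedel's beta function, coding a finite sequence by two numbers through remainders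
  modulo 1 + (i + 1) d.\<close>

definition beta :: "nat \<Rightarrow> nat \<Rightarrow> nat \<Rightarrow> nat" where
  "beta c d i = c mod Suc (Suc i * d)"

text \<open>The factorial \<open>d\<close> is a multiple of all differences of indices, which makes
  the moduli pairwise coprime, and it exceeds the values, so that they are their own remainders. The
  rest is the Chinese remainder theorem.\<close>

lemma beta_exists: "\<exists>c d. \<forall>i\<le>n. beta c d i = r i"
proof -
  define M where "M = Max (insert n (r ` {..n}))"
  define d where "d = (fact (Suc M) :: nat)"
  have M: "i \<le> M" "r i \<le> M" if "i \<le> n" for i
  proof -
    have "n \<le> M" unfolding M_def by (rule Max_ge) auto
    moreover have "r i \<le> M" unfolding M_def by (rule Max_ge) (use that in auto)
    ultimately show "i \<le> M" "r i \<le> M" using that by auto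
  qed
  have cop: "coprime (Suc (Suc i * d)) (Suc (Suc j * d))" if ij: "i \<le> n" "j \<le> n" "i \<noteq> j" for i j
  proof -
    have aux: "coprime (Suc (Suc i * d)) (Suc (Suc j * d))" if ij: "i < j" "j \<le> n" for i j
    proof (rule coprimeI)
      \<comment> \<open>A common divisor \<open>q\<close> is prime to \<open>d\<close> and divides
        \<open>(j - i) * d\<close>, hence \<open>j - i\<close>, hence \<open>d\<close>.\<close>
      fix q assume q: "q dvd Suc (Suc i * d)" "q dvd Suc (Suc j * d)"
      have cd: "coprime q d"
      proof (rule coprimeI)
        fix s assume "s dvd q" "s dvd d"
        then have "s dvd Suc (Suc i * d)" "s dvd Suc i * d" using q(1) dvd_trans by auto
        then have "s dvd Suc (Suc i * d) - Suc i * d" by (rule dvd_diff_nat)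
        then show "is_unit s" by simp
      qed
      have "q dvd Suc (Suc j * d) - Suc (Suc i * d)" using q by (intro dvd_diff_nat)
      also have "Suc (Suc j * d) - Suc (Suc i * d) = (j - i) * d" by (simp add: diff_mult_distrib)
      finally have "q dvd j - i" using cd by (simp add: coprime_dvd_mult_left_iff)
      moreover have "j - i dvd d" unfolding d_def using ij M(1)[OF ij(2)] by (intro dvd_fact) auto
      ultimately have "q dvd d" by (rule dvd_trans)
      then show "is_unit q" using cd by (metis coprime_absorb_left)
    qed
    show ?thesis
    proof (cases "i < j")
      case True
      then show ?thesis using aux ij by blast
    next
      case False
      then have "coprime (Suc (Suc j * d)) (Suc (Suc i * d))" using aux[of j i] ij by simp
      then show ?thesis by (simp only: coprime_commute)
    qed
  qed
  obtain c where c: "\<forall>i\<in>{..n}. [c = r i] (mod Suc (Suc i * d))"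
    using chinese_remainder_nat[of "{..n}" "\<lambda>i. Suc (Suc i * d)" r] cop by auto
  have "beta c d i = r i" if "i \<le> n" for i
  proof -
    have "r i \<le> Suc M" using M(2)[OF that] by simp
    also have "Suc M \<le> d" unfolding d_def by (rule fact_ge_self)
    also have "d \<le> Suc i * d" by simp
    finally have "r i < Suc (Suc i * d)" by simp
    then show ?thesis using c that unfolding beta_def cong_def by simp
  qed
  then show ?thesis by blast
qed

text \<open>Only sums, products and existential quantifiers remain, as representability requires;
  \<open>s\<close> expresses that \<open>r\<close> is below the modulus.\<close>

lemma beta_eq_iff:
  "beta c d i = r \<longleftrightarrow> (\<exists>q. c = q * Suc (Suc i * d) + r) \<and> (\<exists>s. r + s = Suc i * d)"
proof
  assume "beta c d i = r"
  then have r: "r = c mod Suc (Suc i * d)" by (simp add: beta_def)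
  then have "c = (c div Suc (Suc i * d)) * Suc (Suc i * d) + r" by (metis div_mult_mod_eq)
  moreover have "r < Suc (Suc i * d)" unfolding r by (rule mod_less_divisor) simp
  then have "\<exists>s. r + s = Suc i * d" by (intro exI[of _ "Suc i * d - r"]) simp
  ultimately show "(\<exists>q. c = q * Suc (Suc i * d) + r) \<and> (\<exists>s. r + s = Suc i * d)" by blast
next
  assume "(\<exists>q. c = q * Suc (Suc i * d) + r) \<and> (\<exists>s. r + s = Suc i * d)"
  then obtain q s where "c = q * Suc (Suc i * d) + r" "r + s = Suc i * d" by blast
  moreover from this have "r < Suc (Suc i * d)" by simp
  ultimately show "beta c d i = r" unfolding beta_def by (metis mod_less mod_mult_self3)
qed

section \<open>Evaluation of recursive functions as a first-order condition\<close>

lemma rec_eval_RZero_iff: "rec_eval RZero xs y \<longleftrightarrow> y = 0"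
  by (auto elim: eval_ZeroE intro: eval_Zero)

lemma rec_eval_RSucc_iff: "rec_eval RSucc xs y \<longleftrightarrow> (\<exists>x. xs = [x] \<and> y = Suc x)"
  by (auto elim: eval_SuccE intro: eval_Succ)

lemma rec_eval_RProj_iff: "rec_eval (RProj i) xs y \<longleftrightarrow> i < length xs \<and> y = xs ! i"
  by (auto elim: eval_ProjE intro: eval_Proj)

lemma rec_eval_RComp_iff:
  "rec_eval (RComp f gs) xs z \<longleftrightarrow> (\<exists>ys. list_all2 (\<lambda>g y. rec_eval g xs y) gs ys \<and> rec_eval f ys z)"
  by (auto elim: eval_CompE intro: eval_Comp)

lemma rec_eval_RMin_iff:
  "rec_eval (RMin f) xs n \<longleftrightarrow> rec_eval f (n # xs) 0 \<and> (\<forall>m<n. \<exists>k. rec_eval f (m # xs) (Suc k))"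
  by (auto elim: eval_MinE intro: eval_Min)

inductive_cases eval_PrimE: "rec_eval (RPrim f g) xs y"

lemma rec_eval_RPrim_Nil: "\<not> rec_eval (RPrim f g) [] y"
  by (auto elim: eval_PrimE)

lemma rec_eval_RPrim_0_iff: "rec_eval (RPrim f g) (0 # xs) y \<longleftrightarrow> rec_eval f xs y"
  by (auto elim: eval_Prim_0E intro: eval_Prim_0)

lemma rec_eval_RPrim_Suc_iff:
  "rec_eval (RPrim f g) (Suc n # xs) y \<longleftrightarrow>
     (\<exists>r. rec_eval (RPrim f g) (n # xs) r \<and> rec_eval g (n # r # xs) y)"
  by (auto elim: eval_Prim_SucE intro: eval_Prim_Suc)

lemma rec_eval_RPrim_iff_sequence:
  "rec_eval (RPrim f g) (n # xs) y \<longleftrightarrow>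
     (\<exists>r. rec_eval f xs (r 0) \<and> (\<forall>i<n. rec_eval g (i # r i # xs) (r (Suc i))) \<and> r n = y)"
proof (induction n arbitrary: y)
  case 0
  show ?case unfolding rec_eval_RPrim_0_iff by (auto intro!: exI[of _ "\<lambda>_. y"])
next
  case (Suc n)
  show ?case unfolding rec_eval_RPrim_Suc_iff Suc.IH
  proof
    assume "\<exists>s. (\<exists>r. rec_eval f xs (r 0) \<and> (\<forall>i<n. rec_eval g (i # r i # xs) (r (Suc i))) \<and> r n = s) \<and>
      rec_eval g (n # s # xs) y"
    then obtain r where r: "rec_eval f xs (r 0)" "\<forall>i<n. rec_eval g (i # r i # xs) (r (Suc i))"
      "rec_eval g (n # r n # xs) y" by blast
    then show "\<exists>r. rec_eval f xs (r 0) \<and> (\<forall>i<Suc n. rec_eval g (i # r i # xs) (r (Suc i))) \<and> r (Suc n) = y"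
      by (intro exI[of _ "r(Suc n := y)"]) (auto simp: less_Suc_eq)
  next
    assume "\<exists>r. rec_eval f xs (r 0) \<and> (\<forall>i<Suc n. rec_eval g (i # r i # xs) (r (Suc i))) \<and> r (Suc n) = y"
    then obtain r where r: "rec_eval f xs (r 0)" "\<forall>i<Suc n. rec_eval g (i # r i # xs) (r (Suc i))"
      "r (Suc n) = y" by blast
    then show "\<exists>s. (\<exists>r. rec_eval f xs (r 0) \<and> (\<forall>i<n. rec_eval g (i # r i # xs) (r (Suc i))) \<and> r n = s) \<and>
      rec_eval g (n # s # xs) y" by (intro exI[of _ "r n"] conjI exI[of _ r]) auto
  qed
qed

text \<open>The history of the recursion is coded by \<open>c\<close> and \<open>d\<close>. Every
  beta value is named by a variable, and the order is written additively, so that the closure rules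
  for representable predicates apply literally.\<close>

lemma rec_eval_RPrim_iff_beta:
  "rec_eval (RPrim f g) (n # xs) y \<longleftrightarrow>
     (\<exists>c d. (\<exists>r. beta c d 0 = r \<and> rec_eval f xs r) \<and>
        (\<forall>i. (\<exists>s. i + Suc s = n) \<longrightarrow>
           (\<exists>r t. beta c d i = r \<and> beta c d (Suc i) = t \<and> rec_eval g (i # r # xs) t)) \<and>
        beta c d n = y)"
proof -
  have less: "(\<exists>s. i + Suc s = n) \<longleftrightarrow> i < n" for i
    by (auto simp: less_iff_Suc_add)
  show ?thesis unfolding less rec_eval_RPrim_iff_sequence
  proof
    assume "\<exists>r. rec_eval f xs (r 0) \<and> (\<forall>i<n. rec_eval g (i # r i # xs) (r (Suc i))) \<and> r n = y"
    then obtain r where r: "rec_eval f xs (r 0)" "\<forall>i<n. rec_eval g (i # r i # xs) (r (Suc i))" "r n = y"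
      by blast
    obtain c d where cd: "\<forall>i\<le>n. beta c d i = r i" using beta_exists by blast
    show "\<exists>c d. (\<exists>r. beta c d 0 = r \<and> rec_eval f xs r) \<and>
        (\<forall>i<n. \<exists>r t. beta c d i = r \<and> beta c d (Suc i) = t \<and> rec_eval g (i # r # xs) t) \<and> beta c d n = y"
      using r cd by (intro exI[of _ c] exI[of _ d]) simp
  next
    assume "\<exists>c d. (\<exists>r. beta c d 0 = r \<and> rec_eval f xs r) \<and>
        (\<forall>i<n. \<exists>r t. beta c d i = r \<and> beta c d (Suc i) = t \<and> rec_eval g (i # r # xs) t) \<and> beta c d n = y"
    then obtain c d where "rec_eval f xs (beta c d 0)" "beta c d n = y"
      "\<forall>i<n. rec_eval g (i # beta c d i # xs) (beta c d (Suc i))" by blast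
    then show "\<exists>r. rec_eval f xs (r 0) \<and> (\<forall>i<n. rec_eval g (i # r i # xs) (r (Suc i))) \<and> r n = y"
      by (intro exI[of _ "beta c d"]) simp
  qed
qed

section \<open>Computability of the diagonal instance\<close>

fun numeral_term :: "nat \<Rightarrow> ring_term" where
  "numeral_term 0 = Zero"
| "numeral_term (Suc n) = Add One (numeral_term n)"

lemma term_val_numeral_term: "term_val e (numeral_term n) = of_nat n"
  by (induction n) simp_all

lemma term_vars_numeral_term: "term_vars (numeral_term n) = {}"
  by (induction n) simp_all

definition rec_const :: "nat \<Rightarrow> rec_fun" where
  "rec_const n = ((\<lambda>f. RComp RSucc [f]) ^^ n) RZero"

lemma rec_eval_rec_const: "rec_eval (rec_const n) xs n"
proof (induction n)
  case (Suc n)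
  then show ?case by (auto simp: rec_const_def rec_eval_RComp_iff rec_eval_RSucc_iff list_all2_Cons1)
qed (simp add: rec_const_def rec_eval_RZero_iff)

lemma rec_eval_RComp1: "rec_eval g xs a \<Longrightarrow> rec_eval f [a] y \<Longrightarrow> rec_eval (RComp f [g]) xs y"
  by (rule eval_Comp[of _ _ "[a]"]) simp_all

lemma rec_eval_RComp2:
  "rec_eval g xs a \<Longrightarrow> rec_eval h xs b \<Longrightarrow> rec_eval f [a, b] y \<Longrightarrow> rec_eval (RComp f [g, h]) xs y"
  by (rule eval_Comp[of _ _ "[a, b]"]) simp_all

lemma rec_eval_RProj: "i < length xs \<Longrightarrow> xs ! i = y \<Longrightarrow> rec_eval (RProj i) xs y"
  using eval_Proj by blast

definition rec_add :: rec_fun where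
  "rec_add = RPrim (RProj 0) (RComp RSucc [RProj 1])"

lemma rec_eval_rec_add: "rec_eval rec_add [a, b] (a + b)"
proof (induction a)
  case 0
  show ?case unfolding rec_add_def by (simp add: rec_eval_RPrim_0_iff rec_eval_RProj)
next
  case (Suc a)
  have "rec_eval (RComp RSucc [RProj 1]) [a, a + b, b] (Suc (a + b))"
    by (rule rec_eval_RComp1[OF rec_eval_RProj eval_Succ]) simp_all
  then show ?case using Suc unfolding rec_add_def by (auto intro: eval_Prim_Suc)
qed

definition rec_triangle :: rec_fun where
  "rec_triangle = RPrim RZero (RComp RSucc [RComp rec_add [RProj 0, RProj 1]])"

lemma rec_eval_rec_triangle: "rec_eval rec_triangle [n] (triangle n)"
proof (induction n)
  case 0
  show ?case unfolding rec_triangle_def by (simp add: rec_eval_RPrim_0_iff rec_eval_RZero_iff)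
next
  case (Suc n)
  have "rec_eval (RComp rec_add [RProj 0, RProj 1]) [n, triangle n] (n + triangle n)"
    by (rule rec_eval_RComp2[OF rec_eval_RProj rec_eval_RProj rec_eval_rec_add]) simp_all
  then have "rec_eval (RComp RSucc [RComp rec_add [RProj 0, RProj 1]]) [n, triangle n] (Suc (n + triangle n))"
    by (rule rec_eval_RComp1[OF _ eval_Succ])
  then show ?case using Suc unfolding rec_triangle_def
    by (auto intro: eval_Prim_Suc simp: triangle_Suc add.commute)
qed

definition rec_pair :: "rec_fun \<Rightarrow> rec_fun \<Rightarrow> rec_fun" where
  "rec_pair f g = RComp rec_add [RComp rec_triangle [RComp rec_add [f, g]], f]"

lemma rec_eval_rec_pair:
  assumes "rec_eval f xs a" "rec_eval g xs b"
  shows "rec_eval (rec_pair f g) xs (prod_encode (a, b))"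
  unfolding rec_pair_def prod_encode_def prod.case
  using assms rec_eval_RComp1[OF rec_eval_RComp2[OF assms rec_eval_rec_add] rec_eval_rec_triangle]
  by (blast intro: rec_eval_RComp2[OF _ _ rec_eval_rec_add])

definition rec_numeral_code :: rec_fun where
  "rec_numeral_code = RPrim (rec_const (term_code Zero))
     (rec_pair (rec_const 3) (rec_pair (rec_const (term_code One)) (RProj 1)))"

lemma rec_eval_rec_numeral_code: "rec_eval rec_numeral_code [n] (term_code (numeral_term n))"
proof (induction n)
  case 0
  show ?case unfolding rec_numeral_code_def
    using rec_eval_rec_const[of "term_code Zero"] by (simp add: rec_eval_RPrim_0_iff)
next
  case (Suc n)
  have "rec_eval (rec_pair (rec_const 3) (rec_pair (rec_const (term_code One)) (RProj 1)))
     [n, term_code (numeral_term n)] (term_code (numeral_term (Suc n)))"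
    unfolding numeral_term.simps term_code.simps(4)
    by (intro rec_eval_rec_pair rec_eval_rec_const rec_eval_RProj) simp_all
  then show ?case using Suc unfolding rec_numeral_code_def by (auto intro: eval_Prim_Suc)
qed

text \<open>Binding the variable to a numeral replaces substitution: the code of the instance is
  obtained by pairing, without recursion on the syntax of the formula.\<close>

definition instance_at :: "ring_form \<Rightarrow> nat \<Rightarrow> ring_form" where
  "instance_at \<phi> n = Exists 0 (And (Eq (Var 0) (numeral_term n)) \<phi>)"

text \<open>The constants 5, 0, 2, 0 are the tag of \<open>Exists\<close>, the bound variable, the
  tag of \<open>And\<close> and the tag of \<open>Eq\<close>. The input is used twice, as the number
  to be named and as the code of the formula.\<close>

definition rec_diagonal :: rec_fun where
  "rec_diagonal = rec_pair (rec_const 5) (rec_pair (rec_const 0) (rec_pair (rec_const 2)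
     (rec_pair (rec_pair (rec_const 0) (rec_pair (rec_const (term_code (Var 0))) rec_numeral_code)) (RProj 0))))"

lemma rec_eval_rec_diagonal:
  "rec_eval rec_diagonal [form_code \<phi>] (form_code (instance_at \<phi> (form_code \<phi>)))"
  unfolding rec_diagonal_def instance_at_def form_code.simps
  by (intro rec_eval_rec_pair rec_eval_rec_const rec_eval_rec_numeral_code rec_eval_RProj) simp_all

lemma finite_term_vars: "finite (term_vars t)"
  by (induction t) simp_all

lemma finite_free_vars: "finite (free_vars \<phi>)"
  by (induction \<phi>) (simp_all add: finite_term_vars)

text \<open>A representing formula may contain further free variables whose values do not matter;
  they are bound to 0 so that the diagonal instance is a sentence.\<close>

definition close_over :: "nat list \<Rightarrow> ring_form \<Rightarrow> ring_form" where
  "close_over js \<phi> = foldr (\<lambda>j \<chi>. Exists j (And (Eq (Var j) Zero) \<chi>)) js \<phi>"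

lemma free_vars_close_over: "free_vars (close_over js \<phi>) = free_vars \<phi> - set js"
  unfolding close_over_def by (induction js) auto

text \<open>A defining formula is demanded for each variable, because quantifiers will be
  relativized to the naturals at arbitrary indices.\<close>

locale nats_definable =
  fixes R :: "'a::{comm_ring_1, ring_char_0} set"
  assumes Nats_subset: "\<nat> \<subseteq> R"
    and Nats_definable: "\<And>x. \<exists>\<phi>. \<forall>e. e x \<in> R \<longrightarrow> (sat R e \<phi> \<longleftrightarrow> e x \<in> \<nat>)"
begin

text \<open>The first \<open>k\<close> variables hold natural numbers, and \<open>k\<close> itself
  serves as the next fresh variable. Values of the remaining variables are unconstrained and must
  not affect the truth of the formula.\<close>

definition repr :: "nat \<Rightarrow> ((nat \<Rightarrow> nat) \<Rightarrow> bool) \<Rightarrow> bool" where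
  "repr k P \<longleftrightarrow> (\<exists>\<phi>. \<forall>e m. (\<forall>i<k. e i = of_nat (m i)) \<longrightarrow> (sat R e \<phi> \<longleftrightarrow> P m))"

definition repr_term :: "nat \<Rightarrow> ((nat \<Rightarrow> nat) \<Rightarrow> nat) \<Rightarrow> bool" where
  "repr_term k f \<longleftrightarrow> (\<exists>t. \<forall>e m. (\<forall>i<k. e i = of_nat (m i)) \<longrightarrow> term_val e t = (of_nat (f m) :: 'a))"

lemma repr_term_var: "i < k \<Longrightarrow> repr_term k (\<lambda>m. m i)"
  unfolding repr_term_def by (rule exI[of _ "Var i"]) simp

lemma repr_term_const: "repr_term k (\<lambda>m. n)"
  unfolding repr_term_def by (rule exI[of _ "numeral_term n"]) (simp add: term_val_numeral_term)

lemma repr_term_add: "repr_term k f \<Longrightarrow> repr_term k g \<Longrightarrow> repr_term k (\<lambda>m. f m + g m)"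
proof -
  assume "repr_term k f" "repr_term k g"
  then obtain s t where
    s: "\<And>e m. \<forall>i<k. e i = of_nat (m i) \<Longrightarrow> term_val e s = (of_nat (f m) :: 'a)" and
    t: "\<And>e m. \<forall>i<k. e i = of_nat (m i) \<Longrightarrow> term_val e t = (of_nat (g m) :: 'a)"
    unfolding repr_term_def by blast
  show ?thesis unfolding repr_term_def
  proof (intro exI allI impI)
    fix e :: "nat \<Rightarrow> 'a" and m assume e: "\<forall>i<k. e i = of_nat (m i)"
    show "term_val e (Add s t) = of_nat (f m + g m)" by (simp add: s[OF e] t[OF e])
  qed
qed

lemma repr_term_mult: "repr_term k f \<Longrightarrow> repr_term k g \<Longrightarrow> repr_term k (\<lambda>m. f m * g m)"
proof -
  assume "repr_term k f" "repr_term k g"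
  then obtain s t where
    s: "\<And>e m. \<forall>i<k. e i = of_nat (m i) \<Longrightarrow> term_val e s = (of_nat (f m) :: 'a)" and
    t: "\<And>e m. \<forall>i<k. e i = of_nat (m i) \<Longrightarrow> term_val e t = (of_nat (g m) :: 'a)"
    unfolding repr_term_def by blast
  show ?thesis unfolding repr_term_def
  proof (intro exI allI impI)
    fix e :: "nat \<Rightarrow> 'a" and m assume e: "\<forall>i<k. e i = of_nat (m i)"
    show "term_val e (Mult s t) = of_nat (f m * g m)" by (simp add: s[OF e] t[OF e])
  qed
qed

lemma repr_term_Suc: "repr_term k f \<Longrightarrow> repr_term k (\<lambda>m. Suc (f m))"
  using repr_term_add[OF repr_term_const[of k 1]] by simp

lemma repr_term_mono: "repr_term k f \<Longrightarrow> k \<le> l \<Longrightarrow> repr_term l f"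
  unfolding repr_term_def by (meson order_less_le_trans)

lemma repr_term_upd: "repr_term k f \<Longrightarrow> f (m(k := v)) = f m"
proof -
  assume "repr_term k f"
  then obtain t where t: "\<And>e m. (\<forall>i<k. e i = of_nat (m i)) \<Longrightarrow> term_val e t = (of_nat (f m) :: 'a)"
    unfolding repr_term_def by blast
  have "(of_nat (f (m(k := v))) :: 'a) = of_nat (f m)"
    using t[of "\<lambda>i. of_nat (m i)" "m(k := v)"] t[of "\<lambda>i. of_nat (m i)" m] by simp
  then show ?thesis by simp
qed

lemma repr_False: "repr k (\<lambda>m. False)"
  unfolding repr_def by (rule exI[of _ "Neg (Eq Zero Zero)"]) simp

lemma repr_eq: "repr_term k f \<Longrightarrow> repr_term k g \<Longrightarrow> repr k (\<lambda>m. f m = g m)"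
proof -
  assume "repr_term k f" "repr_term k g"
  then obtain s t where
    s: "\<And>e m. \<forall>i<k. e i = of_nat (m i) \<Longrightarrow> term_val e s = (of_nat (f m) :: 'a)" and
    t: "\<And>e m. \<forall>i<k. e i = of_nat (m i) \<Longrightarrow> term_val e t = (of_nat (g m) :: 'a)"
    unfolding repr_term_def by blast
  show ?thesis unfolding repr_def
  proof (intro exI allI impI)
    fix e :: "nat \<Rightarrow> 'a" and m assume e: "\<forall>i<k. e i = of_nat (m i)"
    show "sat R e (Eq s t) \<longleftrightarrow> f m = g m" by (simp add: s[OF e] t[OF e])
  qed
qed

lemma repr_not: "repr k P \<Longrightarrow> repr k (\<lambda>m. \<not> P m)"
proof -
  assume "repr k P"
  then obtain \<phi> where "\<forall>e m. (\<forall>i<k. e i = of_nat (m i)) \<longrightarrow> (sat R e \<phi> \<longleftrightarrow> P m)"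
    unfolding repr_def by blast
  then show ?thesis unfolding repr_def by (intro exI[of _ "Neg \<phi>"]) simp
qed

lemma repr_and: "repr k P \<Longrightarrow> repr k Q \<Longrightarrow> repr k (\<lambda>m. P m \<and> Q m)"
proof -
  assume "repr k P" "repr k Q"
  then obtain \<phi> \<psi> where
    \<phi>: "\<And>e m. \<forall>i<k. e i = of_nat (m i) \<Longrightarrow> sat R e \<phi> \<longleftrightarrow> P m" and
    \<psi>: "\<And>e m. \<forall>i<k. e i = of_nat (m i) \<Longrightarrow> sat R e \<psi> \<longleftrightarrow> Q m"
    unfolding repr_def by blast
  show ?thesis unfolding repr_def
  proof (intro exI allI impI)
    fix e :: "nat \<Rightarrow> 'a" and m assume e: "\<forall>i<k. e i = of_nat (m i)"
    show "sat R e (And \<phi> \<psi>) \<longleftrightarrow> P m \<and> Q m" by (simp add: \<phi>[OF e] \<psi>[OF e])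
  qed
qed

lemma repr_imp: "repr k P \<Longrightarrow> repr k Q \<Longrightarrow> repr k (\<lambda>m. P m \<longrightarrow> Q m)"
  using repr_not[OF repr_and[OF _ repr_not]] by simp

text \<open>The quantifier is relativized to the naturals by conjoining their definition at the
  fresh variable \<open>k\<close>. The second assumption says that \<open>Q\<close> does not look at
  the old value stored there.\<close>

lemma repr_ex:
  assumes "repr (Suc k) (\<lambda>m. Q m (m k))" "\<And>m v. Q (m(k := v)) v = Q m v"
  shows "repr k (\<lambda>m. \<exists>v. Q m v)"
proof -
  obtain \<phi> where \<phi>: "\<And>e m. (\<forall>i<Suc k. e i = of_nat (m i)) \<Longrightarrow> (sat R e \<phi> \<longleftrightarrow> Q m (m k))"
    using assms(1) unfolding repr_def by blast
  obtain \<nu> where \<nu>: "\<And>e. e k \<in> R \<Longrightarrow> (sat R e \<nu> \<longleftrightarrow> e k \<in> \<nat>)" using Nats_definable by blast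
  have "sat R e (Exists k (And \<nu> \<phi>)) \<longleftrightarrow> (\<exists>v. Q m v)" if em: "\<forall>i<k. e i = of_nat (m i)" for e m
  proof -
    have 1: "sat R (e(k := of_nat v)) \<phi> \<longleftrightarrow> Q m v" for v
      using \<phi>[of "e(k := of_nat v)" "m(k := v)"] em assms(2) by (simp add: less_Suc_eq)
    have "sat R e (Exists k (And \<nu> \<phi>)) \<longleftrightarrow> (\<exists>x\<in>R. x \<in> \<nat> \<and> sat R (e(k := x)) \<phi>)"
      using \<nu>[of "e(k := _)"] by auto
    also have "\<dots> \<longleftrightarrow> (\<exists>v::nat. sat R (e(k := of_nat v)) \<phi>)"
      using Nats_subset of_nat_in_Nats by (fastforce elim: Nats_cases)
    finally show ?thesis unfolding 1 .
  qed
  then show ?thesis unfolding repr_def by (intro exI[of _ "Exists k (And \<nu> \<phi>)"]) blast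
qed

lemma repr_all:
  assumes "repr (Suc k) (\<lambda>m. Q m (m k))" "\<And>m v. Q (m(k := v)) v = Q m v"
  shows "repr k (\<lambda>m. \<forall>v. Q m v)"
proof -
  have "repr k (\<lambda>m. \<exists>v. \<not> Q m v)"
    by (rule repr_ex) (use repr_not[OF assms(1)] assms(2) in simp_all)
  then show ?thesis using repr_not by fastforce
qed

lemma repr_beta:
  assumes "repr_term k c" "repr_term k d" "repr_term k i" "repr_term k r"
  shows "repr k (\<lambda>m. beta (c m) (d m) (i m) = r m)"
  unfolding beta_eq_iff
  by (intro repr_and repr_ex repr_eq repr_term_add repr_term_mult repr_term_Suc repr_term_var
      assms[THEN repr_term_mono])
     (simp_all add: assms[THEN repr_term_upd])

text \<open>Arguments and result are passed as variable indices, so that intermediate values of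
  compositions and recursions can be held in fresh variables.\<close>

lemma repr_rec_eval:
  assumes "\<forall>i\<in>set vs. i < k" "y < k"
  shows "repr k (\<lambda>m. rec_eval f (map m vs) (m y))"
  using assms
proof (induction f arbitrary: vs k y)
  case RZero
  then show ?case unfolding rec_eval_RZero_iff by (intro repr_eq repr_term_var repr_term_const)
next
  case RSucc
  show ?case
  proof (cases "length vs = 1")
    case True
    then obtain a where "vs = [a]" by (metis One_nat_def length_0_conv length_Suc_conv)
    then show ?thesis using RSucc unfolding rec_eval_RSucc_iff
      by (simp add: repr_eq repr_term_Suc repr_term_var)
  next
    case False
    then have "\<not> rec_eval RSucc (map m vs) (m y)" for m by (auto simp: rec_eval_RSucc_iff)
    then show ?thesis using repr_False by simp
  qed
next
  case (RProj i)
  show ?case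
  proof (cases "i < length vs")
    case True
    then show ?thesis using RProj unfolding rec_eval_RProj_iff
      by (simp add: repr_eq repr_term_var)
  next
    case False
    then show ?thesis unfolding rec_eval_RProj_iff using repr_False by simp
  qed
next
  case (RComp f gs)
  \<comment> \<open>\<open>ws\<close> collects the variables already holding values of inner
    functions, \<open>hs\<close> are the inner functions still to be evaluated; each step quantifies
    over one more value.\<close>
  have "repr k (\<lambda>m. \<exists>ys. list_all2 (\<lambda>g y. rec_eval g (map m vs) y) hs ys \<and> rec_eval f (map m ws @ ys) (m y))"
    if "set hs \<subseteq> set gs" "\<forall>i\<in>set vs. i < k" "\<forall>i\<in>set ws. i < k" "y < k" for hs ws k
    using that
  proof (induction hs arbitrary: ws k)
    case Nil
    then show ?case using RComp.IH(1)[of ws k y] by simp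
  next
    case (Cons h hs)
    have "repr k (\<lambda>m. \<exists>v. rec_eval h (map m vs) v \<and>
       (\<exists>ys. list_all2 (\<lambda>g y. rec_eval g (map m vs) y) hs ys \<and> rec_eval f (map m ws @ v # ys) (m y)))"
    proof (rule repr_ex)
      have 1: "repr (Suc k) (\<lambda>m. rec_eval h (map m vs) (m k))"
        by (rule RComp.IH(2)) (use Cons.prems in auto)
      have 2: "repr (Suc k) (\<lambda>m. \<exists>ys. list_all2 (\<lambda>g y. rec_eval g (map m vs) y) hs ys \<and>
          rec_eval f (map m (ws @ [k]) @ ys) (m y))"
        by (rule Cons.IH) (use Cons.prems in auto)
      show "repr (Suc k) (\<lambda>m. rec_eval h (map m vs) (m k) \<and>
         (\<exists>ys. list_all2 (\<lambda>g y. rec_eval g (map m vs) y) hs ys \<and> rec_eval f (map m ws @ m k # ys) (m y)))"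
        using repr_and[OF 1 2] by simp
      have "k \<notin> set vs" "k \<notin> set ws" "k \<noteq> y" using Cons.prems by auto
      then show "(rec_eval h (map (m(k := v)) vs) v \<and>
         (\<exists>ys. list_all2 (\<lambda>g y. rec_eval g (map (m(k := v)) vs) y) hs ys \<and>
           rec_eval f (map (m(k := v)) ws @ v # ys) ((m(k := v)) y))) =
        (rec_eval h (map m vs) v \<and>
         (\<exists>ys. list_all2 (\<lambda>g y. rec_eval g (map m vs) y) hs ys \<and> rec_eval f (map m ws @ v # ys) (m y)))" for m v
        by simp
    qed
    moreover have "(\<exists>ys. list_all2 (\<lambda>g y. rec_eval g (map m vs) y) (h # hs) ys \<and> rec_eval f (map m ws @ ys) (m y)) \<longleftrightarrow>
      (\<exists>v. rec_eval h (map m vs) v \<and>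
       (\<exists>ys. list_all2 (\<lambda>g y. rec_eval g (map m vs) y) hs ys \<and> rec_eval f (map m ws @ v # ys) (m y)))" for m
      unfolding list_all2_Cons1 by blast
    ultimately show ?case by simp
  qed
  from this[of gs k "[]"] RComp.prems show ?case unfolding rec_eval_RComp_iff by simp
next
  case (RPrim f g)
  show ?case
  proof (cases vs)
    case Nil
    then show ?thesis using repr_False by (simp add: rec_eval_RPrim_Nil)
  next
    case (Cons a ws)
    have bd: "a < k" "\<forall>i\<in>set ws. i < k" "y < k" using RPrim.prems Cons by auto
    have F: "repr l (\<lambda>m. rec_eval f (map m ws) (m z))" if "k \<le> l" "z < l" for l z
      by (rule RPrim.IH(1)) (use that bd in auto)
    have G: "repr l (\<lambda>m. rec_eval g (m i # m r # map m ws) (m z))" if "k \<le> l" "i < l" "r < l" "z < l" for l i r z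
    proof -
      have "\<forall>j\<in>set (i # r # ws). j < l" using that bd(2) by auto
      from RPrim.IH(2)[OF this that(4)] show ?thesis by simp
    qed
    have upd: "map (m(l := v)) ws = map m ws" if "k \<le> l" for m l v
      using that bd(2) by (intro map_fun_upd) auto
    have ay: "a \<noteq> l" "y \<noteq> l" if "k \<le> l" for l using that bd by auto
    have "repr k (\<lambda>m. \<exists>c d. (\<exists>r. beta c d 0 = r \<and> rec_eval f (map m ws) r) \<and>
        (\<forall>i. (\<exists>s. i + Suc s = m a) \<longrightarrow>
           (\<exists>r t. beta c d i = r \<and> beta c d (Suc i) = t \<and> rec_eval g (i # r # map m ws) t)) \<and>
        beta c d (m a) = m y)"
      using bd(1,3)
      by (intro repr_ex repr_all repr_and repr_imp repr_beta repr_eq repr_term_add repr_term_Suc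
          repr_term_var repr_term_const F G)
         (simp_all add: upd ay)
    then show ?thesis using Cons by (simp add: rec_eval_RPrim_iff_beta)
  qed
next
  case (RMin f)
  have F: "repr l (\<lambda>m. rec_eval f (m i # map m vs) (m z))" if "k \<le> l" "i < l" "z < l" for l i z
  proof -
    have "\<forall>j\<in>set (i # vs). j < l" using that RMin.prems by auto
    from RMin.IH[OF this that(3)] show ?thesis by simp
  qed
  have upd: "map (m(l := v)) vs = map m vs" if "k \<le> l" for m l v
    using that RMin.prems by (intro map_fun_upd) auto
  have y: "y \<noteq> l" if "k \<le> l" for l using that RMin.prems by auto
  have "repr k (\<lambda>m. (\<exists>z. z = 0 \<and> rec_eval f (m y # map m vs) z) \<and>
     (\<forall>n. (\<exists>s. n + Suc s = m y) \<longrightarrow> (\<exists>z. (\<exists>j. z = Suc j) \<and> rec_eval f (n # map m vs) z)))"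
    using RMin.prems
    by (intro repr_ex repr_all repr_and repr_imp repr_eq repr_term_add repr_term_Suc
        repr_term_var repr_term_const F)
       (simp_all add: upd y)
  moreover have "rec_eval (RMin f) xs n \<longleftrightarrow> (\<exists>z. z = 0 \<and> rec_eval f (n # xs) z) \<and>
     (\<forall>i. (\<exists>s. i + Suc s = n) \<longrightarrow> (\<exists>z. (\<exists>j. z = Suc j) \<and> rec_eval f (i # xs) z))" for xs n
    unfolding rec_eval_RMin_iff by (auto simp: less_iff_Suc_add)
  ultimately show ?case by simp
qed

lemma sat_close_over:
  assumes "\<And>e. e 0 = x \<Longrightarrow> sat R e \<phi> \<longleftrightarrow> Q" "0 \<notin> set js" "e 0 = x"
  shows "sat R e (close_over js \<phi>) \<longleftrightarrow> Q"
  using assms(2,3)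
proof (induction js arbitrary: e)
  case Nil
  then show ?case using assms(1) by (simp add: close_over_def)
next
  case (Cons j js)
  have "0 \<in> R" using Nats_subset by auto
  moreover have "sat R (e(j := 0)) (close_over js \<phi>) \<longleftrightarrow> Q"
    by (rule Cons.IH) (use Cons.prems in auto)
  moreover have "close_over (j # js) \<phi> = Exists j (And (Eq (Var j) Zero) (close_over js \<phi>))"
    by (simp add: close_over_def)
  ultimately show ?case by simp
qed

text \<open>Given a decision procedure \<open>f\<close>, diagonalize over the formula stating that \<open>f\<close> rejects the
  instance of a formula at its own code.\<close>

theorem undecidable: "\<not> decidable_theory (first_order_theory R)"
proof
  define T where "T = first_order_theory R"
  assume "decidable_theory (first_order_theory R)"
  then obtain f where f: "\<And>n. rec_eval f [n] (if n \<in> form_code ` T then 1 else 0)"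
    unfolding decidable_theory_def decidable_def T_def by blast
  define g where "g = RComp f [rec_diagonal]"
  \<comment> \<open>The constant result is introduced through a variable because
    \<open>repr_rec_eval\<close> takes the result as an index.\<close>
  have "repr 1 (\<lambda>m. \<exists>z. z = 0 \<and> rec_eval g (map m [0]) z)"
    by (intro repr_ex repr_and repr_eq repr_term_var repr_term_const repr_rec_eval) simp_all
  then have "repr 1 (\<lambda>m. rec_eval g [m 0] 0)" by simp
  then obtain \<phi>0 where \<phi>0: "\<And>e m. (\<forall>i<1. e i = of_nat (m i)) \<Longrightarrow> sat R e \<phi>0 \<longleftrightarrow> rec_eval g [m 0] 0"
    unfolding repr_def by blast
  obtain js where js: "set js = free_vars \<phi>0 - {0}"
    using finite_list[of "free_vars \<phi>0 - {0}"] finite_free_vars by blast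
  define \<phi> where "\<phi> = close_over js \<phi>0"
  have fv: "free_vars \<phi> \<subseteq> {0}" unfolding \<phi>_def free_vars_close_over js by blast
  have \<phi>: "sat R e \<phi> \<longleftrightarrow> rec_eval g [n] 0" if "e 0 = of_nat n" for e n
    unfolding \<phi>_def
  proof (rule sat_close_over[where x = "of_nat n"])
    show "sat R e \<phi>0 \<longleftrightarrow> rec_eval g [n] 0" if "e 0 = of_nat n" for e
      using \<phi>0[of e "\<lambda>_. n"] that by simp
  qed (use js that in auto)
  define S where "S = instance_at \<phi> (form_code \<phi>)"
  have "free_vars S = {}" unfolding S_def instance_at_def using fv by (auto simp: term_vars_numeral_term)
  then have "S \<in> T \<longleftrightarrow> sat R (\<lambda>_. 0) S" unfolding T_def first_order_theory_def by simp
  also have "\<dots> \<longleftrightarrow> rec_eval g [form_code \<phi>] 0"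
    using Nats_subset of_nat_in_Nats \<phi>[of "(\<lambda>_. 0)(0 := of_nat (form_code \<phi>))" "form_code \<phi>"]
    unfolding S_def instance_at_def by (auto simp: term_val_numeral_term)
  \<comment> \<open>\<open>g\<close> applies the decision procedure to the code of \<open>S\<close>;
    determinism of evaluation makes 0 the only possible answer when the code is rejected and
    excludes it otherwise.\<close>
  also have "\<dots> \<longleftrightarrow> form_code S \<notin> form_code ` T"
  proof -
    have "rec_eval g [form_code \<phi>] (if form_code S \<in> form_code ` T then 1 else 0)"
      unfolding g_def S_def using rec_eval_RComp1[OF rec_eval_rec_diagonal f] .
    then show ?thesis using rec_eval_deterministic by fastforce
  qed
  also have "\<dots> \<longleftrightarrow> S \<notin> T" using form_code_inj by auto
  finally show False by blast
qed

end

section \<open>The defining formulas\<close>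

definition unit_form :: "ring_term \<Rightarrow> nat \<Rightarrow> nat \<Rightarrow> ring_form" where
  "unit_form t g u = (let s = Add One (Mult (numeral_term 3) (Var g)) in
     And (Eq (Mult (Var g) (Var g)) (Mult (Mult (numeral_term 4) (Mult t t)) s))
         (Eq (Mult s (Var u)) One))"

lemma sat_unit_form:
  "sat R e (unit_form t g u) \<longleftrightarrow>
     (e g)\<^sup>2 = 4 * (term_val e t)\<^sup>2 * (1 + 3 * e g) \<and> (1 + 3 * e g) * e u = 1"
  by (simp add: unit_form_def Let_def term_val_numeral_term power2_eq_square del: numeral_term.simps)

text \<open>\<open>x\<close> is the variable described and \<open>k\<close> the start of a block of
  bound variables; choosing \<open>x < k\<close> prevents capture when such formulas are
  nested.\<close>

definition Z_tr_form :: "nat \<Rightarrow> nat \<Rightarrow> ring_form" where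
  "Z_tr_form x k = Exists k (Exists (k + 1) (Exists (k + 2) (Exists (k + 3)
     (And (unit_form (Var x) k (k + 1)) (unit_form (Add (Var x) One) (k + 2) (k + 3))))))"

lemma sat_Z_tr_form:
  assumes "x < k" "e x \<in> Z_tr_i"
  shows "sat Z_tr_i e (Z_tr_form x k) \<longleftrightarrow> e x \<in> Z_tr"
  using assms unfolding Z_tr_existential_characterization[OF assms(2)] Z_tr_form_def
  by (simp add: sat_unit_form)

definition root_of_unity_form :: "nat \<Rightarrow> nat \<Rightarrow> ring_form" where
  "root_of_unity_form x k = Exists k (Exists (k + 1) (Exists (k + 2)
     (And (And (Z_tr_form k (k + 3)) (Z_tr_form (k + 1) (k + 3)))
     (And (Eq (Mult (Var (k + 2)) (Var (k + 2))) (Minus One))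
     (And (Eq (Mult (numeral_term 2) (Var x)) (Add (Var k) (Mult (Var (k + 1)) (Var (k + 2)))))
          (Eq (Add (Mult (Var k) (Var k)) (Mult (Var (k + 1)) (Var (k + 1)))) (numeral_term 4)))))))"

lemma sat_root_of_unity_form:
  assumes "x < k" "e x \<in> Z_tr_i"
  shows "sat Z_tr_i e (root_of_unity_form x k) \<longleftrightarrow> root_of_unity (e x)"
proof -
  have "sat Z_tr_i e (root_of_unity_form x k) \<longleftrightarrow>
    (\<exists>a\<in>Z_tr_i. \<exists>b\<in>Z_tr_i. \<exists>j\<in>Z_tr_i. (a \<in> Z_tr \<and> b \<in> Z_tr) \<and>
       j\<^sup>2 = - 1 \<and> 2 * e x = a + b * j \<and> a\<^sup>2 + b\<^sup>2 = 4)"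
    using assms unfolding root_of_unity_form_def
    by (simp add: sat_Z_tr_form term_val_numeral_term power2_eq_square del: numeral_term.simps)
  also have "\<dots> \<longleftrightarrow> root_of_unity (e x)"
    unfolding root_of_unity_characterization[OF assms(2)] using Z_tr_iff_real by blast
  finally show ?thesis .
qed

definition nat_form :: "nat \<Rightarrow> nat \<Rightarrow> ring_form" where
  "nat_form x k =
     (let z = Add (Var k) (Minus One) in
      And (Forall k (Implies (root_of_unity_form k (k + 1)) (Implies (Neg (Eq (Var k) One))
            (Exists (k + 1) (Exists (k + 2) (And (root_of_unity_form (k + 1) (k + 3))
               (Eq (Add (Add (Var (k + 1)) (Minus One)) (Minus (Mult (Var x) z)))
                   (Mult (Var (k + 2)) (Mult z z)))))))))
          (Exists k (And (Z_tr_form k (k + 1)) (Eq (Mult (Var k) (Var k)) (Var x)))))"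

lemma sat_nat_form:
  assumes "x < k" "e x \<in> Z_tr_i"
  shows "sat Z_tr_i e (nat_form x k) \<longleftrightarrow> e x \<in> \<nat>"
proof -
  have "sat Z_tr_i e (nat_form x k) \<longleftrightarrow>
    (\<forall>z\<in>Z_tr_i. root_of_unity z \<longrightarrow> z \<noteq> 1 \<longrightarrow> (\<exists>u\<in>Z_tr_i. \<exists>w\<in>Z_tr_i. root_of_unity u \<and>
        u - 1 - e x * (z - 1) = w * (z - 1)\<^sup>2)) \<and> (\<exists>r\<in>Z_tr_i. r \<in> Z_tr \<and> r\<^sup>2 = e x)"
    using assms unfolding nat_form_def Let_def
    by (simp add: sat_Z_tr_form sat_root_of_unity_form power2_eq_square)
  also have "\<dots> \<longleftrightarrow> integer_condition (e x) \<and> (\<exists>r\<in>Z_tr. r\<^sup>2 = e x)"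
    unfolding integer_condition_def using root_of_unity_in_Z_tr_i(3) Z_tr_iff_real by blast
  also have "\<dots> \<longleftrightarrow> e x \<in> \<nat>" using Nats_characterization[OF assms(2)] by blast
  finally show ?thesis .
qed

interpretation nats_definable Z_tr_i
proof
  show "\<nat> \<subseteq> Z_tr_i" using Z_tr_i_of_nat by (auto elim: Nats_cases)
  show "\<exists>\<phi>. \<forall>e. e x \<in> Z_tr_i \<longrightarrow> (sat Z_tr_i e \<phi> \<longleftrightarrow> e x \<in> \<nat>)" for x
    using sat_nat_form[of x "Suc x"] by blast
qed

theorem theorem1p1:
  shows "existentially_definable_in (ring_of_integers Q_tr_i) Z_tr \<and>
         \<not> decidable_theory (first_order_theory (ring_of_integers Q_tr_i))"
proof
  have "existential (Z_tr_form 0 1)"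
    unfolding Z_tr_form_def unit_form_def Let_def
    by (intro existential_Exists existential_qf) simp
  moreover have "free_vars (Z_tr_form 0 1) \<subseteq> {0}"
    unfolding Z_tr_form_def unit_form_def Let_def by (auto simp: term_vars_numeral_term)
  moreover have "Z_tr = {x \<in> Z_tr_i. sat Z_tr_i (\<lambda>_. x) (Z_tr_form 0 1)}"
    using sat_Z_tr_form[of 0 1 "\<lambda>_. _"] Z_tr_iff_real by auto
  ultimately show "existentially_definable_in Z_tr_i Z_tr"
    unfolding existentially_definable_in_def by blast
  show "\<not> decidable_theory (first_order_theory Z_tr_i)" by (rule undecidable)
qed

end
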